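(* Let $T$ be a tree of order $n\geq 6$ and let $\mu$ be a Laplacian eigenvalue of $T$ with $\mu\neq 1$. Then $m_T(\mu)\leq \frac{n-3}{2}$. Moreover, equality $m_T(\mu)=\frac{n-3}{2}$ holds if and only if $T\cong T\!\left(\frac{n-1}{2},\frac{n-1}{2}\right)$ and $\mu=\frac{3\pm\sqrt{5}}{2}$. In particular, if equality holds, then $\mu$ is the algebraic connectivity $\mu_2(T)$ of $T$ or its conjugate.
   Context: For a graph $G$ on $n$ vertices, the Laplacian matrix is $L(G)=D(G)-A(G)$, where $D(G)$ is the diagonal matrix of vertex degrees and $A(G)$ the adjacency matrix. Its eigenvalues, the Laplacian eigenvalues, are denoted $0=\mu_1(G)\leq\mu_2(G)\leq\cdots\leq\mu_n(G)$; $\mu_2(G)$ is called the algebraic connectivity. $m_G(\mu)$ denotes the multiplicity of $\mu$ as a Laplacian eigenvalue of $G$. Two Laplacian eigenvalues are conjugates if they are roots of the same irreducible (over $\mathbb{Q}$) factor of the characteristic polynomial of $L(G)$. For integers $1\leq k\leq s$, the spider $T(s,k)$ is the tree obtained from the star $K_{1,s}$ by extending $k$ of its $s$ rays (edges from the center) by one extra edge each (so each of these $k$ rays becomes a path of length $2$ from the center); it has $s+k+1$ vertices. *)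

theory Defs
  imports "Jordan_Normal_Form.Char_Poly" "HOL-Computational_Algebra.Polynomial"
begin

definition simple_graph :: "nat \<Rightarrow> (nat \<Rightarrow> nat \<Rightarrow> bool) \<Rightarrow> bool" where
  "simple_graph n E \<longleftrightarrow>
     (\<forall>u v. E u v \<longrightarrow> u < n \<and> v < n) \<and> (\<forall>u v. E u v \<longrightarrow> E v u) \<and> (\<forall>u. \<not> E u u)"

definition edge_set :: "nat \<Rightarrow> (nat \<Rightarrow> nat \<Rightarrow> bool) \<Rightarrow> nat set set" where
  "edge_set n E = {{u, v} | u v. u < n \<and> v < n \<and> E u v}"

definition connected_graph :: "nat \<Rightarrow> (nat \<Rightarrow> nat \<Rightarrow> bool) \<Rightarrow> bool" where
  "connected_graph n E \<longleftrightarrow> (\<forall>u v. u < n \<longrightarrow> v < n \<longrightarrow> E\<^sup>*\<^sup>* u v)"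

definition is_tree :: "nat \<Rightarrow> (nat \<Rightarrow> nat \<Rightarrow> bool) \<Rightarrow> bool" where
  "is_tree n E \<longleftrightarrow> n \<ge> 1 \<and> simple_graph n E \<and> connected_graph n E \<and> card (edge_set n E) = n - 1"

definition degree :: "nat \<Rightarrow> (nat \<Rightarrow> nat \<Rightarrow> bool) \<Rightarrow> nat \<Rightarrow> nat" where
  "degree n E v = card {u. u < n \<and> E v u}"

definition laplacian :: "nat \<Rightarrow> (nat \<Rightarrow> nat \<Rightarrow> bool) \<Rightarrow> 'a :: comm_ring_1 mat" where
  "laplacian n E = mat n n (\<lambda>(i, j). if i = j then of_nat (degree n E i)
                                     else if E i j then -1 else 0)"

text \<open>Multiplicity of mu as Laplacian eigenvalue (algebraic = geometric, L symmetric).\<close>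
definition lap_mult :: "nat \<Rightarrow> (nat \<Rightarrow> nat \<Rightarrow> bool) \<Rightarrow> real \<Rightarrow> nat" where
  "lap_mult n E \<mu> = order \<mu> (char_poly (laplacian n E :: real mat))"

text \<open>Laplacian eigenvalues in non-decreasing order, with multiplicity: mu_1 = lap_spectrum ! 0, ...\<close>
definition lap_spectrum :: "nat \<Rightarrow> (nat \<Rightarrow> nat \<Rightarrow> bool) \<Rightarrow> real list" where
  "lap_spectrum n E = (THE xs. sorted xs \<and>
      char_poly (laplacian n E :: real mat) = (\<Prod>x\<leftarrow>xs. [:- x, 1:]))"

definition alg_conn :: "nat \<Rightarrow> (nat \<Rightarrow> nat \<Rightarrow> bool) \<Rightarrow> real" where
  "alg_conn n E = lap_spectrum n E ! 1"

definition lap_conjugates :: "nat \<Rightarrow> (nat \<Rightarrow> nat \<Rightarrow> bool) \<Rightarrow> real \<Rightarrow> real \<Rightarrow> bool" where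
  "lap_conjugates n E a b \<longleftrightarrow>
     (\<exists>p :: rat poly. irreducible p \<and> p dvd char_poly (laplacian n E :: rat mat) \<and>
        poly (map_poly of_rat p) a = 0 \<and> poly (map_poly of_rat p) b = 0)"

definition graph_iso :: "nat \<Rightarrow> (nat \<Rightarrow> nat \<Rightarrow> bool) \<Rightarrow> nat \<Rightarrow> (nat \<Rightarrow> nat \<Rightarrow> bool) \<Rightarrow> bool" where
  "graph_iso n E m F \<longleftrightarrow> (\<exists>f. bij_betw f {0..<n} {0..<m} \<and>
      (\<forall>u v. u < n \<longrightarrow> v < n \<longrightarrow> (E u v \<longleftrightarrow> F (f u) (f v))))"

text \<open>Spider T(s,k) on vertices {0..<s+k+1}: centre 0, rays to 1..s, and vertex s+i
  attached to i for 1 \<le> i \<le> k.\<close>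
definition spider_edge :: "nat \<Rightarrow> nat \<Rightarrow> nat \<Rightarrow> nat \<Rightarrow> bool" where
  "spider_edge s k u v \<longleftrightarrow>
     (u = 0 \<and> 1 \<le> v \<and> v \<le> s) \<or> (v = 0 \<and> 1 \<le> u \<and> u \<le> s) \<or>
     (1 \<le> u \<and> u \<le> k \<and> v = s + u) \<or> (1 \<le> v \<and> v \<le> k \<and> u = s + v)"

definition spider_order :: "nat \<Rightarrow> nat \<Rightarrow> nat" where
  "spider_order s k = s + k + 1"

end

theory Submission
  imports Defs
begin

text \<open>
  An eigenfunction for \<open>\<mu> \<noteq> 1\<close> vanishes on a leaf iff it vanishes on the neighbour of that leaf.
  Rooting the tree at a vertex with a leaf attached and working upwards, one sees that an
  eigenfunction vanishing on all but one of the \<open>q\<close> vertices carrying leaves vanishes identically, so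
  \<open>m(\<mu>) \<le> q - 1\<close> if \<open>q \<ge> 2\<close>; moreover \<open>2 q \<le> n\<close>. If \<open>n\<close> is \<open>2 q\<close> or \<open>2 q + 1\<close>, then at most one vertex
  \<open>z\<close> is neither a leaf nor adjacent to a leaf, and unless the tree is the spider with centre \<open>z\<close> one
  finds a path \<open>a b c\<close> or \<open>a b z c\<close> along which zeros propagate, so that two of the \<open>q\<close> vertices can be
  omitted and \<open>m(\<mu>) \<le> q - 2\<close>. Bounding the algebraic multiplicity in this way uses that real
  symmetric matrices are diagonalizable.
\<close>

section \<open>Diagonalization of real symmetric matrices\<close>

text \<open>Upper bounds rest on one count: if only the zero \<open>\<mu>\<close>-eigenfunction
  vanishes on \<open>S\<close>, then evaluation on \<open>S\<close> is injective on the eigenspace,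
  whose dimension is at most \<open>card S\<close>. The bound \<open>q - 1\<close> equals
  \<open>(n - 3) / 2\<close> for \<open>n = 2 q + 1\<close> and is at most
  \<open>(n - 4) / 2\<close> for \<open>n \<ge> 2 q + 2\<close>. A further saving is needed for
  \<open>n = 2 q\<close>, where \<open>q - 1\<close> exceeds the claim by one half, and for
  \<open>n = 2 q + 1\<close> in order to isolate equality. There \<open>n \<ge> 6\<close> gives
  \<open>q \<ge> 3\<close>; the path on five vertices, which is \<open>T(2,2)\<close>, attains
  \<open>(n - 3) / 2 = 1\<close> at each of its eigenvalues. The numbers
  \<open>(3 \<plusminus> sqrt 5) / 2\<close> are the eigenvalues of the block with rows
  \<open>(2, -1)\<close> and \<open>(-1, 1)\<close> that the Laplacian has on a leg of the spider:
  eigenvectors of this block on several legs, with zero at the centre, need only cancel in the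
  equation of the centre.\<close>

lemma underdetermined_system:
  fixes M :: "'a \<Rightarrow> 'b \<Rightarrow> 'c :: field"
  assumes "finite I" "finite J" "card I < card J"
  obtains c where "\<forall>i\<in>I. (\<Sum>j\<in>J. M i j * c j) = 0" and "\<exists>j\<in>J. c j \<noteq> 0"
proof -
  have "\<exists>c. (\<forall>i\<in>I. (\<Sum>j\<in>J. M i j * c j) = 0) \<and> (\<exists>j\<in>J. c j \<noteq> 0)"
    using assms
  proof (induction I arbitrary: J M rule: finite_induct)
    case empty
    then have "J \<noteq> {}" by auto
    then show ?case by (intro exI[of _ "\<lambda>_. 1"]) auto
  next
    case (insert i I)
    show ?case
    proof (cases "\<forall>j\<in>J. M i j = 0")
      case True
      moreover obtain c where "\<forall>i\<in>I. (\<Sum>j\<in>J. M i j * c j) = 0" "\<exists>j\<in>J. c j \<noteq> 0"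
        using insert.IH[of J M] insert.prems insert.hyps by auto
      ultimately show ?thesis by (intro exI[of _ c]) auto
    next
      case False
      then obtain p where p: "p \<in> J" "M i p \<noteq> 0" by auto
      define J' where "J' = J - {p}"
      have J': "finite J'" "p \<notin> J'" "J = insert p J'" "card I < card J'"
        using p insert.prems insert.hyps by (auto simp: J'_def)
      \<comment> \<open>Gaussian elimination: equation \<open>i\<close> is solved for the pivot
        unknown \<open>p\<close>, and these coefficients are what its substitution leaves in
        equation \<open>k\<close>.\<close>
      obtain c where c: "\<forall>k\<in>I. (\<Sum>j\<in>J'. (M k j - M k p * M i j / M i p) * c j) = 0"
          and nz: "\<exists>j\<in>J'. c j \<noteq> 0"
        using insert.IH[of J' "\<lambda>k j. M k j - M k p * M i j / M i p"] J' by auto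
      define s where "s = (\<Sum>j\<in>J'. M i j * c j)"
      define c' where "c' = c(p := - s / M i p)"
      have c'J': "(\<Sum>j\<in>J'. f j * c' j) = (\<Sum>j\<in>J'. f j * c j)" for f
        using J' by (intro sum.cong) (auto simp: c'_def)
      have c'J: "(\<Sum>j\<in>J. M k j * c' j) = M k p * (- s / M i p) + (\<Sum>j\<in>J'. M k j * c j)" for k
        using J' c'J'[of "M k"] by (simp add: c'_def)
      have "(\<Sum>j\<in>J. M k j * c' j) = 0" if "k \<in> insert i I" for k
      proof (cases "k = i")
        case True
        then show ?thesis using c'J[of i] p by (simp add: s_def)
      next
        case False
        then have "k \<in> I" using that by simp
        then have "0 = (\<Sum>j\<in>J'. (M k j - M k p * M i j / M i p) * c j)" using c by simp
        also have "\<dots> = (\<Sum>j\<in>J'. M k j * c j) - (\<Sum>j\<in>J'. M k p / M i p * (M i j * c j))"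
          by (simp add: sum_subtractf algebra_simps)
        also have "\<dots> = (\<Sum>j\<in>J'. M k j * c j) - M k p / M i p * s"
          by (simp add: s_def sum_distrib_left)
        finally show ?thesis using c'J[of k] by simp
      qed
      moreover have "\<exists>j\<in>J. c' j \<noteq> 0" using nz J' by (auto simp: c'_def)
      ultimately show ?thesis by blast
    qed
  qed
  then show ?thesis using that by blast
qed

text \<open>The fundamental theorem of algebra gives a complex eigenpair \<open>e\<close>,
  \<open>z\<close>. By symmetry the form \<open>F = e * N\<close> equals its conjugate, and
  \<open>N\<close> is a nonzero real, so \<open>e\<close> is real. The eigenvector is then taken
  afresh from the real matrix, since \<open>z\<close> need not be real.\<close>

lemma symmetric_real_eigenvector:
  fixes A :: "real mat"
  assumes A: "A \<in> carrier_mat n n" and sym: "transpose_mat A = A" and n: "n > 0"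
  obtains k v where "v \<in> carrier_vec n" "v \<noteq> 0\<^sub>v n" "A *\<^sub>v v = k \<cdot>\<^sub>v v"
proof -
  define C :: "complex mat" where "C = map_mat of_real A"
  have C: "C \<in> carrier_mat n n" using A by (simp add: C_def)
  have "Polynomial.degree (char_poly C) = n" using degree_monic_char_poly[OF C] by simp
  then have "\<not> constant (poly (char_poly C))" using n by (simp add: constant_degree)
  then obtain e where "poly (char_poly C) e = 0"
    using fundamental_theorem_of_algebra by blast
  then have "eigenvalue C e" using eigenvalue_root_char_poly[OF C] by simp
  then obtain z where z: "z \<in> carrier_vec n" "z \<noteq> 0\<^sub>v n" "C *\<^sub>v z = e \<cdot>\<^sub>v z"
    using C by (auto simp: eigenvalue_def eigenvector_def)
  have row: "(\<Sum>j<n. of_real (A $$ (i,j)) * z $ j) = e * z $ i" if "i < n" for i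
  proof -
    have "(C *\<^sub>v z) $ i = e * z $ i" using z that by simp
    moreover have "(C *\<^sub>v z) $ i = (\<Sum>j<n. of_real (A $$ (i,j)) * z $ j)"
      using that C z(1) A by (auto simp: scalar_prod_def C_def atLeast0LessThan intro!: sum.cong)
    ultimately show ?thesis by simp
  qed
  have symA: "A $$ (i,j) = A $$ (j,i)" if "i < n" "j < n" for i j
    using arg_cong[OF sym, of "\<lambda>B. B $$ (j,i)"] that A by simp
  define N where "N = (\<Sum>i<n. cnj (z $ i) * z $ i)"
  have Nre: "N = of_real (\<Sum>i<n. (cmod (z $ i))\<^sup>2)"
    unfolding N_def of_real_sum complex_norm_square by (simp add: mult.commute)
  define F where "F = (\<Sum>i<n. \<Sum>j<n. cnj (z $ i) * of_real (A $$ (i,j)) * z $ j)"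
  have F1: "F = e * N"
  proof -
    have "F = (\<Sum>i<n. cnj (z $ i) * (\<Sum>j<n. of_real (A $$ (i,j)) * z $ j))"
      by (simp add: F_def sum_distrib_left mult.assoc)
    also have "\<dots> = (\<Sum>i<n. cnj (z $ i) * (e * z $ i))"
      by (intro sum.cong) (auto simp: row)
    also have "\<dots> = e * N" by (simp add: N_def sum_distrib_left ac_simps)
    finally show ?thesis .
  qed
  have "cnj F = (\<Sum>j<n. \<Sum>i<n. z $ i * of_real (A $$ (i,j)) * cnj (z $ j))"
    unfolding F_def by (subst sum.swap) simp
  also have "\<dots> = F"
    unfolding F_def by (intro sum.cong refl) (auto simp: symA)
  finally have "cnj (e * N) = e * N" using F1 by simp
  moreover have "N \<noteq> 0"
  proof
    assume "N = 0"
    then have "(\<Sum>i<n. (cmod (z $ i))\<^sup>2) = 0" using Nre by (metis of_real_eq_0_iff)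
    then have "\<forall>i<n. z $ i = 0" by (subst (asm) sum_nonneg_eq_0_iff) auto
    then have "z = 0\<^sub>v n" using z(1) by (intro eq_vecI) auto
    then show False using z by simp
  qed
  moreover have "cnj N = N" using Nre by simp
  ultimately have "cnj e = e" by simp
  then obtain r where r: "e = of_real r" by (metis Reals_cases Reals_cnj_iff)
  have "poly (char_poly C) (of_real r) = of_real (poly (char_poly A) r)"
    unfolding C_def of_real_hom.char_poly_hom[OF A] by simp
  then have "poly (char_poly A) r = 0" using \<open>poly (char_poly C) e = 0\<close> r by simp
  then have "eigenvalue A r" using eigenvalue_root_char_poly[OF A] by simp
  then show ?thesis using that A by (auto simp: eigenvalue_def eigenvector_def)
qed

text \<open>The Householder reflection exchanging the unit vectors \<open>v\<close> and \<open>e\<^sub>0\<close>. For \<open>v = e\<^sub>0\<close>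
  the factor \<open>1 / (1 - v\<^sub>0)\<close> is the junk value \<open>0\<close>, which makes the reflection the identity, as it
  should be.\<close>

lemma householder_reflection:
  fixes v :: "real vec"
  assumes v: "v \<in> carrier_vec n" and unit: "(\<Sum>i<n. (v $ i)\<^sup>2) = 1" and n: "n > 0"
  obtains W where "W \<in> carrier_mat n n" "transpose_mat W = W" "W * W = 1\<^sub>m n"
    "W *\<^sub>v unit_vec n 0 = v" "W *\<^sub>v v = unit_vec n 0"
proof -
  define \<delta> :: "nat \<Rightarrow> nat \<Rightarrow> real" where "\<delta> i j = (if i = j then 1 else 0)" for i j
  define u where "u i = v $ i - \<delta> i 0" for i
  \<comment> \<open>This is \<open>2 / |u|\<^sup>2\<close>, because
    \<open>|u|\<^sup>2 = 2 (1 - v\<^sub>0)\<close> for a unit vector \<open>v\<close>.\<close>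
  define c where "c = 1 / (1 - v $ 0)"
  define W where "W = mat n n (\<lambda>(i,j). \<delta> i j - c * u i * u j)"
  have W: "W \<in> carrier_mat n n" by (simp add: W_def)
  have Wsym: "transpose_mat W = W"
    by (rule eq_matI) (auto simp: W_def \<delta>_def)
  have app: "(\<Sum>k<n. (\<delta> i k - c * u i * u k) * g k) = g i - c * u i * (\<Sum>k<n. u k * g k)"
    if "i < n" for i g
  proof -
    have "(\<Sum>k<n. (\<delta> i k - c * u i * u k) * g k) = (\<Sum>k<n. \<delta> i k * g k) - c * u i * (\<Sum>k<n. u k * g k)"
      by (simp add: sum_subtractf algebra_simps sum_distrib_left)
    moreover have "(\<Sum>k<n. \<delta> i k * g k) = (\<Sum>k<n. if k = i then g k else 0)"
      by (intro sum.cong) (auto simp: \<delta>_def)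
    ultimately show ?thesis using that by simp
  qed
  have \<delta>0: "(\<Sum>k<n. g k * \<delta> k j) = g j" if "j < n" for g j
  proof -
    have "(\<Sum>k<n. g k * \<delta> k j) = (\<Sum>k<n. if k = j then g k else 0)"
      by (intro sum.cong) (auto simp: \<delta>_def)
    then show ?thesis using that by simp
  qed
  have vv: "(\<Sum>k<n. v $ k * v $ k) = 1" using unit by (simp add: power2_eq_square)
  have uv: "(\<Sum>k<n. u k * v $ k) = 1 - v $ 0"
    using \<delta>0[of 0 "\<lambda>k. v $ k"] n vv by (simp add: u_def algebra_simps sum_subtractf)
  have uu: "(\<Sum>k<n. u k * u k) = 2 * (1 - v $ 0)"
  proof -
    have "u k * u k = u k * v $ k - u k * \<delta> k 0" for k by (simp add: u_def algebra_simps)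
    then have "(\<Sum>k<n. u k * u k) = (\<Sum>k<n. u k * v $ k) - (\<Sum>k<n. u k * \<delta> k 0)"
      by (simp add: sum_subtractf)
    then show ?thesis using uv \<delta>0[of 0 u] n by (simp add: u_def \<delta>_def)
  qed
  have c1: "c * (1 - v $ 0) * u i = u i" if "i < n" for i
  proof (cases "v $ 0 = 1")
    case True
    then have "(\<Sum>k<n. u k * u k) = 0" using uu by simp
    then have "u i = 0" using that by (subst (asm) sum_nonneg_eq_0_iff) auto
    then show ?thesis by simp
  next
    case False
    then show ?thesis by (simp add: c_def)
  qed
  have WW: "W * W = 1\<^sub>m n"
  proof (rule eq_matI)
    fix i j assume "i < dim_row (1\<^sub>m n :: real mat)" "j < dim_col (1\<^sub>m n :: real mat)"
    then have ij: "i < n" "j < n" by auto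
    have "(W * W) $$ (i,j) = (\<Sum>k<n. (\<delta> i k - c * u i * u k) * (\<delta> k j - c * u k * u j))"
      using ij by (simp add: W_def scalar_prod_def atLeast0LessThan)
    also have "\<dots> = \<delta> i j - c * u i * u j - c * u i * (\<Sum>k<n. u k * (\<delta> k j - c * u k * u j))"
      using app[OF ij(1), of "\<lambda>k. \<delta> k j - c * u k * u j"] by simp
    also have "(\<Sum>k<n. u k * (\<delta> k j - c * u k * u j)) = u j - c * u j * (\<Sum>k<n. u k * u k)"
      using \<delta>0[OF ij(2), of u] by (simp add: sum_subtractf algebra_simps sum_distrib_left)
    also have "\<dots> = u j - 2 * (c * (1 - v $ 0) * u j)" by (simp add: uu)
    also have "\<dots> = - u j" using c1[OF ij(2)] by simp
    finally show "(W * W) $$ (i,j) = 1\<^sub>m n $$ (i,j)" using ij by (simp add: \<delta>_def)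
  qed (auto simp: W_def)
  have Wv: "W *\<^sub>v v = unit_vec n 0"
  proof (rule eq_vecI)
    fix i assume "i < dim_vec (unit_vec n 0 :: real vec)"
    then have i: "i < n" by simp
    have "(W *\<^sub>v v) $ i = (\<Sum>k<n. (\<delta> i k - c * u i * u k) * v $ k)"
      using i v by (simp add: W_def scalar_prod_def atLeast0LessThan)
    also have "\<dots> = v $ i - c * u i * (1 - v $ 0)" using app[OF i, of "\<lambda>k. v $ k"] uv by simp
    also have "\<dots> = \<delta> i 0" using c1[OF i] by (simp add: u_def algebra_simps)
    finally show "(W *\<^sub>v v) $ i = unit_vec n 0 $ i" using i n by (simp add: \<delta>_def)
  qed (auto simp: W_def)
  have "W *\<^sub>v (W *\<^sub>v v) = v" using assoc_mult_mat_vec[OF W W v] WW v by simp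
  then show ?thesis using that W Wsym WW Wv by simp
qed

text \<open>Conjugation by a reflection \<open>W\<close> that takes a unit eigenvector to the first
  unit vector turns the first column into \<open>k\<close> followed by zeros. As \<open>W\<close> is
  symmetric and its own inverse, the conjugate is similar to \<open>A\<close> and again symmetric,
  which clears the first row too.\<close>

lemma symmetric_deflation:
  fixes A :: "real mat"
  assumes A: "A \<in> carrier_mat (Suc m) (Suc m)" and sym: "transpose_mat A = A"
  obtains k A' where "A' \<in> carrier_mat m m" "transpose_mat A' = A'"
    "similar_mat A (four_block_mat (mat 1 1 (\<lambda>_. k)) (0\<^sub>m 1 m) (0\<^sub>m m 1) A')"
proof -
  let ?n = "Suc m"
  obtain k v0 where v0: "v0 \<in> carrier_vec ?n" "v0 \<noteq> 0\<^sub>v ?n" "A *\<^sub>v v0 = k \<cdot>\<^sub>v v0"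
    using symmetric_real_eigenvector[OF A sym zero_less_Suc] by blast
  define s where "s = (\<Sum>i<?n. (v0 $ i)\<^sup>2)"
  have "s \<noteq> 0"
  proof
    assume "s = 0"
    then have "\<forall>i<?n. v0 $ i = 0" unfolding s_def by (subst (asm) sum_nonneg_eq_0_iff) auto
    then have "v0 = 0\<^sub>v ?n" using v0(1) by (intro eq_vecI) auto
    then show False using v0 by simp
  qed
  moreover have "s \<ge> 0" unfolding s_def by (intro sum_nonneg) simp
  ultimately have s: "s > 0" by simp
  define v where "v = (1 / sqrt s) \<cdot>\<^sub>v v0"
  have v: "v \<in> carrier_vec ?n" using v0 by (simp add: v_def)
  have "(\<Sum>i<?n. (v $ i)\<^sup>2) = (\<Sum>i<?n. (v0 $ i)\<^sup>2 / s)"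
    using v0 s by (intro sum.cong) (auto simp: v_def power_mult_distrib power_divide)
  also have "\<dots> = 1" using s unfolding s_def sum_divide_distrib[symmetric] by simp
  finally have unit: "(\<Sum>i<?n. (v $ i)\<^sup>2) = 1" .
  have Av: "A *\<^sub>v v = k \<cdot>\<^sub>v v"
    using v0 A by (simp add: v_def mult_mat_vec[OF A v0(1)] smult_smult_assoc mult.commute)
  obtain W where W: "W \<in> carrier_mat ?n ?n" "transpose_mat W = W" "W * W = 1\<^sub>m ?n"
    "W *\<^sub>v unit_vec ?n 0 = v" "W *\<^sub>v v = unit_vec ?n 0"
    using householder_reflection[OF v unit] by auto
  define B where "B = W * A * W"
  have B: "B \<in> carrier_mat ?n ?n" using W A by (simp add: B_def)
  have WA: "W * A \<in> carrier_mat ?n ?n" using W(1) A by simp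
  have "transpose_mat B = transpose_mat W * (transpose_mat A * transpose_mat W)"
    unfolding B_def transpose_mult[OF WA W(1)] transpose_mult[OF W(1) A] ..
  then have Bsym: "transpose_mat B = B"
    unfolding W(2) sym B_def assoc_mult_mat[OF W(1) A W(1)] .
  have e: "unit_vec ?n 0 \<in> carrier_vec ?n" by simp
  have "B *\<^sub>v unit_vec ?n 0 = W *\<^sub>v (A *\<^sub>v (W *\<^sub>v unit_vec ?n 0))"
    using W(1) A e by (simp add: B_def assoc_mult_mat_vec[of _ ?n ?n _ ?n])
  also have "\<dots> = k \<cdot>\<^sub>v unit_vec ?n 0"
    using W v Av by (simp add: mult_mat_vec[OF W(1) v])
  finally have Be: "B *\<^sub>v unit_vec ?n 0 = k \<cdot>\<^sub>v unit_vec ?n 0" .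
  have Bi0: "B $$ (i,0) = (if i = 0 then k else 0)" if "i < ?n" for i
  proof -
    have "(B *\<^sub>v unit_vec ?n 0) $ i = B $$ (i,0)"
      using B that by simp
    then show ?thesis using Be that by (auto split: if_splits)
  qed
  have B0i: "B $$ (0,i) = (if i = 0 then k else 0)" if "i < ?n" for i
    using arg_cong[OF Bsym, of "\<lambda>M. M $$ (0,i)"] Bi0[OF that] that B by simp
  define A' where "A' = mat m m (\<lambda>(i,j). B $$ (Suc i, Suc j))"
  have A': "A' \<in> carrier_mat m m" by (simp add: A'_def)
  have A'sym: "transpose_mat A' = A'"
  proof (rule eq_matI)
    fix i j assume "i < dim_row A'" "j < dim_col A'"
    then show "transpose_mat A' $$ (i,j) = A' $$ (i,j)"
      using arg_cong[OF Bsym, of "\<lambda>M. M $$ (Suc i,Suc j)"] B by (simp add: A'_def)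
  qed (auto simp: A'_def)
  have "B = four_block_mat (mat 1 1 (\<lambda>_. k)) (0\<^sub>m 1 m) (0\<^sub>m m 1) A'"
  proof (rule eq_matI)
    fix i j assume "i < dim_row (four_block_mat (mat 1 1 (\<lambda>_. k)) (0\<^sub>m 1 m) (0\<^sub>m m 1) A')"
      "j < dim_col (four_block_mat (mat 1 1 (\<lambda>_. k)) (0\<^sub>m 1 m) (0\<^sub>m m 1) A')"
    then have "i < ?n" "j < ?n" using A' by auto
    then show "B $$ (i,j) = four_block_mat (mat 1 1 (\<lambda>_. k)) (0\<^sub>m 1 m) (0\<^sub>m m 1) A' $$ (i,j)"
      using Bi0[of i] B0i[of j] by (cases i; cases j) (auto simp: A'_def)
  qed (use A' B in auto)
  moreover have "similar_mat A B"
  proof (rule similar_matI[of _ _ W W ?n])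
    have "W * B = (W * W) * A * W"
      unfolding B_def assoc_mult_mat[OF W(1) WA W(1), symmetric]
        assoc_mult_mat[OF W(1) W(1) A] ..
    also have "\<dots> = A * W" unfolding W(3) using A by simp
    finally have "W * B * W = A * (W * W)" using assoc_mult_mat[OF A W(1) W(1)] by simp
    then show "A = W * B * W" unfolding W(3) using A by simp
  qed (use A B W in auto)
  ultimately show ?thesis using that A' A'sym by simp
qed

lemma symmetric_similar_diagonal:
  fixes A :: "real mat"
  assumes "A \<in> carrier_mat n n" and "transpose_mat A = A"
  shows "\<exists>D. similar_mat A D \<and> D \<in> carrier_mat n n \<and> diagonal_mat D"
  using assms
proof (induction n arbitrary: A)
  case 0
  then show ?case by (intro exI[of _ A]) (auto simp: diagonal_mat_def intro: similar_mat_refl)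
next
  case (Suc m)
  obtain k A' where A': "A' \<in> carrier_mat m m" "transpose_mat A' = A'"
    "similar_mat A (four_block_mat (mat 1 1 (\<lambda>_. k)) (0\<^sub>m 1 m) (0\<^sub>m m 1) A')"
    using symmetric_deflation[OF Suc.prems] by blast
  obtain D where D: "similar_mat A' D" "D \<in> carrier_mat m m" "diagonal_mat D"
    using Suc.IH[OF A'(1,2)] by blast
  let ?D = "four_block_mat (mat 1 1 (\<lambda>_. k)) (0\<^sub>m 1 m) (0\<^sub>m m 1) D"
  have "similar_mat A ?D"
    by (rule similar_mat_trans[OF A'(3) similar_mat_four_block_0_0[OF similar_mat_refl D(1) _ A'(1)]]) auto
  moreover have "?D \<in> carrier_mat (Suc m) (Suc m)"
    using four_block_carrier_mat[OF _ D(2), of "mat 1 1 (\<lambda>_. k)" 1 1] by simp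
  moreover have "diagonal_mat ?D"
    unfolding diagonal_mat_def using D(3)[unfolded diagonal_mat_def, rule_format] D(2) by auto
  ultimately show ?case by blast
qed

lemma order_prod_linear_factors:
  fixes a :: "'a :: idom"
  shows "order a (\<Prod>x\<leftarrow>xs. [:- x, 1:]) = count_list xs a"
proof (induction xs)
  case (Cons x xs)
  have nz: "[:- x, 1:] * (\<Prod>x\<leftarrow>xs. [:- x, 1:]) \<noteq> 0" by (auto simp: prod_list_zero_iff simp del: mult_pCons_left)
  have "order a [:- x, 1:] = (if x = a then 1 else 0)"
    using order_power_n_n[of a 1] by (auto intro!: order_0I)
  then show ?case using Cons order_mult[OF nz, of a] by simp
qed (simp add: order_0I)

definition matrix_eigenfun :: "nat \<Rightarrow> real mat \<Rightarrow> real \<Rightarrow> (nat \<Rightarrow> real) \<Rightarrow> bool" where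
  "matrix_eigenfun n A \<mu> x \<longleftrightarrow> (\<forall>i<n. (\<Sum>j<n. A $$ (i,j) * x j) = \<mu> * x i)"

text \<open>Entries of a diagonalization \<open>A = P D Q\<close> with \<open>Q\<close> inverse to
  \<open>P\<close>. By \<open>A P = P D\<close> the columns of \<open>P\<close> are eigenfunctions,
  and by \<open>Q A = D Q\<close> the \<open>k\<close>-th coordinate of a
  \<open>\<mu>\<close>-eigenfunction can be nonzero only if \<open>d k = \<mu>\<close>. The last two
  facts are \<open>P Q = 1\<close> and \<open>Q P = 1\<close>, applied to functions.\<close>

lemma symmetric_eigenbasis:
  fixes A :: "real mat"
  assumes A: "A \<in> carrier_mat n n" and sym: "transpose_mat A = A"
  obtains d P Q where
    "char_poly A = (\<Prod>x\<leftarrow>map d [0..<n]. [:- x, 1:])"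
    "\<forall>k<n. matrix_eigenfun n A (d k) (\<lambda>i. P i k)"
    "\<forall>\<mu> x. matrix_eigenfun n A \<mu> x \<longrightarrow>
       (\<forall>k<n. d k * (\<Sum>i<n. Q k i * x i) = \<mu> * (\<Sum>i<n. Q k i * x i))"
    "\<forall>x. \<forall>i<n. (\<Sum>k<n. P i k * (\<Sum>j<n. Q k j * x j)) = x i"
    "\<forall>y. \<forall>k<n. (\<Sum>i<n. Q k i * (\<Sum>l<n. P i l * y l)) = y k"
proof -
  obtain D where D: "similar_mat A D" "D \<in> carrier_mat n n" "diagonal_mat D"
    using symmetric_similar_diagonal[OF A sym] by blast
  obtain P Q where PQ: "similar_mat_wit A D P Q" using D(1) by (auto simp: similar_mat_def)
  note w = similar_mat_witD2[OF A PQ]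
  define d where "d k = D $$ (k,k)" for k
  have "upper_triangular D" using D(2,3) by (auto simp: diagonal_mat_def)
  then have cp: "char_poly A = (\<Prod>x\<leftarrow>map d [0..<n]. [:- x, 1:])"
    using char_poly_upper_triangular[OF D(2)] char_poly_similar[OF D(1)] D(2)
    by (simp add: diag_mat_def d_def[abs_def])
  have PD: "A * P = P * D"
  proof -
    have "A * P = P * D * (Q * P)" unfolding w(3) using w(5-7)
      by (intro assoc_mult_mat) auto
    then show ?thesis unfolding w(2) using w(5,6) by simp
  qed
  have QD: "Q * A = D * Q"
  proof -
    have "Q * A = (Q * (P * D)) * Q" unfolding w(3) using w(5-7)
      by (intro assoc_mult_mat[symmetric]) auto
    also have "Q * (P * D) = (Q * P) * D" using w(5-7)
      by (intro assoc_mult_mat[symmetric]) auto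
    finally show ?thesis unfolding w(2) using w(5,7) by simp
  qed
  have ent: "(\<Sum>j<n. X $$ (i,j) * Y $$ (j,k)) = (X * Y) $$ (i,k)"
    if "X \<in> carrier_mat n n" "Y \<in> carrier_mat n n" "i < n" "k < n" for X Y :: "real mat" and i k
    using that by (simp add: scalar_prod_def atLeast0LessThan)
  have diagR: "(\<Sum>j<n. X j * D $$ (j,k)) = X k * d k" if "k < n" for X k
  proof -
    have "(\<Sum>j<n. X j * D $$ (j,k)) = (\<Sum>j<n. if j = k then X j * d j else 0)"
      using D(2,3) that by (intro sum.cong) (auto simp: diagonal_mat_def d_def)
    then show ?thesis using that by simp
  qed
  have diagL: "(\<Sum>j<n. D $$ (k,j) * X j) = X k * d k" if "k < n" for X k
  proof -
    have "(\<Sum>j<n. D $$ (k,j) * X j) = (\<Sum>j<n. if j = k then X j * d j else 0)"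
      using D(2,3) that by (intro sum.cong) (auto simp: diagonal_mat_def d_def)
    then show ?thesis using that by simp
  qed
  have inv: "(\<Sum>k<n. X $$ (i,k) * (\<Sum>j<n. Y $$ (k,j) * x j)) = x i"
    if "X \<in> carrier_mat n n" "Y \<in> carrier_mat n n" "X * Y = 1\<^sub>m n" "i < n" for X Y :: "real mat" and i x
  proof -
    have "(\<Sum>k<n. X $$ (i,k) * (\<Sum>j<n. Y $$ (k,j) * x j))
        = (\<Sum>j<n. (\<Sum>k<n. X $$ (i,k) * Y $$ (k,j)) * x j)"
      by (simp add: sum_distrib_left sum_distrib_right mult.assoc) (rule sum.swap)
    also have "\<dots> = (\<Sum>j<n. if j = i then x j else 0)"
      using that ent[OF that(1,2)] by (intro sum.cong) auto
    finally show ?thesis using that by simp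
  qed
  have ev: "matrix_eigenfun n A (d k) (\<lambda>i. P $$ (i, k))" if k: "k < n" for k
    unfolding matrix_eigenfun_def
  proof (intro allI impI)
      fix i assume i: "i < n"
      have "(\<Sum>j<n. A $$ (i,j) * P $$ (j,k)) = (\<Sum>j<n. P $$ (i,j) * D $$ (j,k))"
        using ent[OF A w(6) i k] ent[OF w(6) D(2) i k] PD by simp
      then show "(\<Sum>j<n. A $$ (i,j) * P $$ (j,k)) = d k * P $$ (i,k)"
        using diagR[OF k, of "\<lambda>j. P $$ (i,j)"] by simp
  qed
  have co: "d k * (\<Sum>i<n. Q $$ (k,i) * x i) = \<mu> * (\<Sum>i<n. Q $$ (k,i) * x i)"
    if x: "matrix_eigenfun n A \<mu> x" and k: "k < n" for \<mu> x k
  proof -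
    have "d k * (\<Sum>i<n. Q $$ (k,i) * x i) = (\<Sum>i<n. (d k * Q $$ (k,i)) * x i)"
      by (simp add: sum_distrib_left mult.assoc)
    also have "\<dots> = (\<Sum>i<n. (\<Sum>j<n. Q $$ (k,j) * A $$ (j,i)) * x i)"
    proof (intro sum.cong refl)
      fix i assume "i \<in> {..<n}"
      then have i: "i < n" by simp
      have "(\<Sum>j<n. Q $$ (k,j) * A $$ (j,i)) = (\<Sum>j<n. D $$ (k,j) * Q $$ (j,i))"
        using ent[OF w(7) A k i] ent[OF D(2) w(7) k i] QD by simp
      then show "d k * Q $$ (k,i) * x i = (\<Sum>j<n. Q $$ (k,j) * A $$ (j,i)) * x i"
        using diagL[OF k, of "\<lambda>j. Q $$ (j,i)"] by simp
    qed
    also have "\<dots> = (\<Sum>j<n. Q $$ (k,j) * (\<Sum>i<n. A $$ (j,i) * x i))"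
      by (simp add: sum_distrib_left sum_distrib_right mult.assoc) (rule sum.swap)
    also have "\<dots> = (\<Sum>j<n. Q $$ (k,j) * (\<mu> * x j))"
      using x by (intro sum.cong) (auto simp: matrix_eigenfun_def)
    finally show "d k * (\<Sum>i<n. Q $$ (k,i) * x i) = \<mu> * (\<Sum>i<n. Q $$ (k,i) * x i)"
      by (simp add: sum_distrib_left ac_simps)
  qed
  show ?thesis
    by (rule that[of d "\<lambda>i k. P $$ (i,k)" "\<lambda>i k. Q $$ (i,k)"]) (use cp ev co inv w in auto)
qed

section \<open>Algebraic multiplicity and the dimension of the eigenspace\<close>

lemma order_eq_card_diag:
  fixes p :: "real poly"
  assumes "p = (\<Prod>x\<leftarrow>map d [0..<n]. [:- x, 1:])"
  shows "order \<mu> p = card {k. k < n \<and> d k = \<mu>}"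
proof -
  have "count_list (map d [0..<n]) \<mu> = card {k. k < n \<and> d k = \<mu>}"
  proof (induction n)
    case (Suc n)
    have "{k. k < Suc n \<and> d k = \<mu>} = (if d n = \<mu> then {n} else {}) \<union> {k. k < n \<and> d k = \<mu>}"
      by (auto simp: less_Suc_eq)
    then show ?case using Suc by (simp add: card_insert_if)
  qed simp
  then show ?thesis using assms order_prod_linear_factors[of \<mu> "map d [0..<n]"] by simp
qed

text \<open>If more than \<open>card S\<close> columns of \<open>P\<close> belonged to
  \<open>\<mu>\<close>, a nontrivial combination of them would vanish on \<open>S\<close> and hence
  everywhere, against \<open>Q P = 1\<close>.\<close>

lemma symmetric_order_le_card:
  fixes A :: "real mat"
  assumes A: "A \<in> carrier_mat n n" and sym: "transpose_mat A = A" and S: "finite S"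
    and forcing: "\<And>x. matrix_eigenfun n A \<mu> x \<Longrightarrow> \<forall>v\<in>S. x v = 0 \<Longrightarrow> \<forall>v<n. x v = 0"
  shows "order \<mu> (char_poly A) \<le> card S"
proof (rule ccontr)
  assume neg: "\<not> order \<mu> (char_poly A) \<le> card S"
  obtain d P Q where
    cp: "char_poly A = (\<Prod>x\<leftarrow>map d [0..<n]. [:- x, 1:])" and
    P: "\<forall>k<n. matrix_eigenfun n A (d k) (\<lambda>i. P i k)" and
    Q: "\<forall>\<mu> x. matrix_eigenfun n A \<mu> x \<longrightarrow>
          (\<forall>k<n. d k * (\<Sum>i<n. Q k i * x i) = \<mu> * (\<Sum>i<n. Q k i * x i))" and
    PQ: "\<forall>x. \<forall>i<n. (\<Sum>k<n. P i k * (\<Sum>j<n. Q k j * x j)) = x i" and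
    QP: "\<forall>y. \<forall>k<n. (\<Sum>i<n. Q k i * (\<Sum>l<n. P i l * y l)) = y k"
    by (rule symmetric_eigenbasis[OF A sym])
  define K where "K = {k. k < n \<and> d k = \<mu>}"
  have K: "finite K" by (simp add: K_def)
  have "card S < card K" using neg order_eq_card_diag[OF cp] by (simp add: K_def)
  then obtain c where c: "\<forall>s\<in>S. (\<Sum>k\<in>K. P s k * c k) = 0" and nz: "\<exists>k\<in>K. c k \<noteq> 0"
    by (rule underdetermined_system[OF S K])
  define x where "x i = (\<Sum>k\<in>K. P i k * c k)" for i
  have "matrix_eigenfun n A \<mu> x"
    unfolding matrix_eigenfun_def
  proof (intro allI impI)
    fix i assume i: "i < n"
    have "(\<Sum>j<n. A $$ (i,j) * x j) = (\<Sum>k\<in>K. (\<Sum>j<n. A $$ (i,j) * P j k) * c k)"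
      by (simp add: x_def sum_distrib_left sum_distrib_right mult.assoc) (rule sum.swap)
    also have "\<dots> = (\<Sum>k\<in>K. \<mu> * P i k * c k)"
      using P i by (intro sum.cong) (auto simp: matrix_eigenfun_def K_def)
    finally show "(\<Sum>j<n. A $$ (i,j) * x j) = \<mu> * x i"
      by (simp add: x_def sum_distrib_left mult.assoc)
  qed
  moreover have "\<forall>v\<in>S. x v = 0" using c by (simp add: x_def)
  ultimately have x0: "\<forall>v<n. x v = 0" using forcing by blast
  define y where "y k = (if k \<in> K then c k else 0)" for k
  have "x i = (\<Sum>l<n. P i l * y l)" for i
    unfolding x_def y_def
    by (intro sum.mono_neutral_cong_left) (auto simp: K_def)
  then have "y k = 0" if "k < n" for k using QP[rule_format, OF that, of y] x0 by simp
  moreover obtain k where "k \<in> K" "c k \<noteq> 0" using nz by blast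
  ultimately show False by (force simp: y_def K_def)
qed

text \<open>The dual count: with too many functions \<open>f j\<close>, some nontrivial combination
  has zero coordinates at all \<open>k\<close> with \<open>d k = \<mu>\<close>. The other
  coordinates of a \<open>\<mu>\<close>-eigenfunction are zero anyway, so the combination is the
  zero function.\<close>

lemma card_le_symmetric_order:
  fixes A :: "real mat"
  assumes A: "A \<in> carrier_mat n n" and sym: "transpose_mat A = A" and J: "finite J"
    and ev: "\<And>j. j \<in> J \<Longrightarrow> matrix_eigenfun n A \<mu> (f j)"
    and indep: "\<And>c. \<forall>v<n. (\<Sum>j\<in>J. c j * f j v) = 0 \<Longrightarrow> \<forall>j\<in>J. c j = 0"
  shows "card J \<le> order \<mu> (char_poly A)"
proof (rule ccontr)
  assume neg: "\<not> card J \<le> order \<mu> (char_poly A)"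
  obtain d P Q where
    cp: "char_poly A = (\<Prod>x\<leftarrow>map d [0..<n]. [:- x, 1:])" and
    P: "\<forall>k<n. matrix_eigenfun n A (d k) (\<lambda>i. P i k)" and
    Q: "\<forall>\<mu> x. matrix_eigenfun n A \<mu> x \<longrightarrow>
          (\<forall>k<n. d k * (\<Sum>i<n. Q k i * x i) = \<mu> * (\<Sum>i<n. Q k i * x i))" and
    PQ: "\<forall>x. \<forall>i<n. (\<Sum>k<n. P i k * (\<Sum>j<n. Q k j * x j)) = x i" and
    QP: "\<forall>y. \<forall>k<n. (\<Sum>i<n. Q k i * (\<Sum>l<n. P i l * y l)) = y k"
    by (rule symmetric_eigenbasis[OF A sym])
  define K where "K = {k. k < n \<and> d k = \<mu>}"
  have K: "finite K" by (simp add: K_def)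
  have "card K < card J" using neg order_eq_card_diag[OF cp] by (simp add: K_def)
  then obtain c where c: "\<forall>k\<in>K. (\<Sum>j\<in>J. (\<Sum>i<n. Q k i * f j i) * c j) = 0" and nz: "\<exists>j\<in>J. c j \<noteq> 0"
    by (rule underdetermined_system[OF K J])
  define x where "x i = (\<Sum>j\<in>J. c j * f j i)" for i
  have Qx: "(\<Sum>i<n. Q k i * x i) = (\<Sum>j\<in>J. (\<Sum>i<n. Q k i * f j i) * c j)" for k
    by (simp add: x_def sum_distrib_left sum_distrib_right ac_simps) (rule sum.swap)
  have "(\<Sum>i<n. Q k i * x i) = 0" if "k < n" for k
  proof (cases "k \<in> K")
    case True
    then show ?thesis using Qx c by simp
  next
    case False
    then have "(\<Sum>i<n. Q k i * f j i) = 0" if "j \<in> J" for j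
      using Q[rule_format, OF ev[OF that] \<open>k < n\<close>] \<open>k < n\<close> by (simp add: K_def)
    then show ?thesis using Qx by simp
  qed
  then have "\<forall>v<n. x v = 0" using PQ[rule_format, of _ x] by fastforce
  then show False using indep[of c] nz by (auto simp: x_def)
qed

section \<open>Laplacian eigenfunctions on rooted trees\<close>

text \<open>The equation \<open>L x = \<mu> x\<close> at \<open>v\<close>, solved for the sum over
  the neighbours: at a zero of \<open>x\<close> the right-hand side disappears, whatever
  \<open>\<mu>\<close> is.\<close>

definition lap_eigenfun :: "nat \<Rightarrow> (nat \<Rightarrow> nat \<Rightarrow> bool) \<Rightarrow> real \<Rightarrow> (nat \<Rightarrow> real) \<Rightarrow> bool" where
  "lap_eigenfun n E \<mu> x \<longleftrightarrow>
     (\<forall>v<n. (\<Sum>u | u < n \<and> E v u. x u) = (real (degree n E v) - \<mu>) * x v)"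

lemma laplacian_carrier: "laplacian n E \<in> carrier_mat n n"
  by (simp add: laplacian_def)

lemma laplacian_symmetric:
  assumes "simple_graph n E"
  shows "transpose_mat (laplacian n E) = laplacian n E"
  using assms by (intro eq_matI) (auto simp: laplacian_def simple_graph_def)

lemma matrix_eigenfun_laplacian:
  assumes "simple_graph n E"
  shows "matrix_eigenfun n (laplacian n E) \<mu> x \<longleftrightarrow> lap_eigenfun n E \<mu> x"
proof -
  have "(\<Sum>j<n. laplacian n E $$ (i,j) * x j) = real (degree n E i) * x i - (\<Sum>u | u < n \<and> E i u. x u)"
    if i: "i < n" for i
  proof -
    have "(\<Sum>j<n. laplacian n E $$ (i,j) * x j)
        = (\<Sum>j<n. (if j = i then real (degree n E i) * x j else 0) - (if E i j then x j else 0))"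
      using assms i by (intro sum.cong) (auto simp: laplacian_def simple_graph_def)
    also have "\<dots> = real (degree n E i) * x i - (\<Sum>j<n. if E i j then x j else 0)"
      using i by (simp add: sum_subtractf)
    also have "(\<Sum>j<n. if E i j then x j else 0) = (\<Sum>u | u < n \<and> E i u. x u)"
      by (intro sum.mono_neutral_cong_right) auto
    finally show ?thesis .
  qed
  moreover have "a - s = \<mu> * b \<longleftrightarrow> s = a - \<mu> * b" for a b s :: real by auto
  ultimately show ?thesis
    by (simp add: matrix_eigenfun_def lap_eigenfun_def left_diff_distrib)
qed

text \<open>Source of every upper bound on a multiplicity below; \<open>S\<close> is a set from
  which zeros spread to all vertices.\<close>

lemma lap_mult_le_card:
  assumes G: "simple_graph n E" and S: "finite S"
    and forcing: "\<And>x. lap_eigenfun n E \<mu> x \<Longrightarrow> \<forall>v\<in>S. x v = 0 \<Longrightarrow> \<forall>v<n. x v = 0"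
  shows "lap_mult n E \<mu> \<le> card S"
  unfolding lap_mult_def
proof (rule symmetric_order_le_card[OF laplacian_carrier laplacian_symmetric[OF G] S])
  show "\<forall>v<n. x v = 0" if "matrix_eigenfun n (laplacian n E) \<mu> x" "\<forall>v\<in>S. x v = 0" for x
    using forcing that matrix_eigenfun_laplacian[OF G] by blast
qed

lemma card_le_lap_mult:
  assumes G: "simple_graph n E" and J: "finite J"
    and ev: "\<And>j. j \<in> J \<Longrightarrow> lap_eigenfun n E \<mu> (f j)"
    and indep: "\<And>c. \<forall>v<n. (\<Sum>j\<in>J. c j * f j v) = 0 \<Longrightarrow> \<forall>j\<in>J. c j = 0"
  shows "card J \<le> lap_mult n E \<mu>"
  unfolding lap_mult_def
proof (rule card_le_symmetric_order[OF laplacian_carrier laplacian_symmetric[OF G] J])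
  show "matrix_eigenfun n (laplacian n E) \<mu> (f j)" if "j \<in> J" for j
    using ev[OF that] matrix_eigenfun_laplacian[OF G] by blast
qed (rule indep)

text \<open>The values at the neighbours of a zero add up to zero, so exactly one of them cannot be
  nonzero. Together with the rule for leaves, this is the move by which zeros spread.\<close>

lemma lap_eigenfun_force:
  assumes G: "simple_graph n E" and x: "lap_eigenfun n E \<mu> x"
    and "x v = 0" "E v u" "\<And>w. E v w \<Longrightarrow> w \<noteq> u \<Longrightarrow> x w = 0"
  shows "x u = 0"
proof -
  have vu: "v < n" "u < n" using G assms(4) by (auto simp: simple_graph_def)
  have "(\<Sum>w | w < n \<and> E v w. x w) = (\<Sum>w\<in>{u}. x w)"
    using assms vu by (intro sum.mono_neutral_right) auto
  then show ?thesis using x vu assms(3) by (auto simp: lap_eigenfun_def)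
qed

section \<open>Leaves, the vertices carrying them, and the spread of zeros in a rooted tree\<close>

definition pendant :: "(nat \<Rightarrow> nat \<Rightarrow> bool) \<Rightarrow> nat \<Rightarrow> nat \<Rightarrow> bool" where
  "pendant E l w \<longleftrightarrow> E l w \<and> (\<forall>u. E l u \<longrightarrow> u = w)"

definition quasi_pendants :: "(nat \<Rightarrow> nat \<Rightarrow> bool) \<Rightarrow> nat set" where
  "quasi_pendants E = {w. \<exists>l. pendant E l w}"

lemma pendant_quasi_pendants: "pendant E l w \<Longrightarrow> w \<in> quasi_pendants E"
  by (auto simp: quasi_pendants_def)

lemma lap_eigenfun_pendant:
  assumes G: "simple_graph n E" and x: "lap_eigenfun n E \<mu> x" and l: "pendant E l w"
  shows "x w = (1 - \<mu>) * x l"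
proof -
  have "E l w" using l by (simp add: pendant_def)
  then have lw: "l < n" "w < n" using G by (auto simp: simple_graph_def)
  have "{u. u < n \<and> E l u} = {w}" using l lw by (auto simp: pendant_def)
  then show ?thesis using x lw by (auto simp: lap_eigenfun_def degree_def)
qed

text \<open>The point where \<open>\<mu> \<noteq> 1\<close> enters. For \<open>\<mu> = 1\<close> a
  zero at \<open>w\<close> says nothing about its leaves, and a star on \<open>n\<close> vertices
  has multiplicity \<open>n - 2\<close>.\<close>

lemma lap_eigenfun_pendant_zero_iff:
  assumes "simple_graph n E" "lap_eigenfun n E \<mu> x" "pendant E l w" "\<mu> \<noteq> 1"
  shows "x l = 0 \<longleftrightarrow> x w = 0"
  using lap_eigenfun_pendant[OF assms(1-3)] assms(4) by simp

text \<open>Acyclicity is carried by \<open>edge_parent\<close>: every edge joins a vertex to its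
  parent. The values of \<open>parent\<close> and \<open>depth\<close> at the root are left
  open.\<close>

locale rooted_tree =
  fixes n :: nat and E :: "nat \<Rightarrow> nat \<Rightarrow> bool" and r :: nat
    and parent :: "nat \<Rightarrow> nat" and depth :: "nat \<Rightarrow> nat"
  assumes simple: "simple_graph n E" and root: "r < n"
    and parent_edge: "v < n \<Longrightarrow> v \<noteq> r \<Longrightarrow> E v (parent v)"
    and depth_parent: "v < n \<Longrightarrow> v \<noteq> r \<Longrightarrow> depth v = Suc (depth (parent v))"
    and edge_parent: "E u v \<Longrightarrow> (u \<noteq> r \<and> parent u = v) \<or> (v \<noteq> r \<and> parent v = u)"

text \<open>Sending each non-root vertex to the edge towards its parent is injective; a tree has exactly
  \<open>n - 1\<close> edges, so every edge arises in this way.\<close>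

lemma tree_rooted:
  assumes T: "is_tree n E" and r: "r < n"
  obtains parent depth where "rooted_tree n E r parent depth"
proof -
  have G: "simple_graph n E" and conn: "connected_graph n E" and ce: "card (edge_set n E) = n - 1"
    using T unfolding is_tree_def by blast+
  have sym: "E u v \<Longrightarrow> E v u" and bd: "E u v \<Longrightarrow> u < n \<and> v < n" for u v
    using G by (auto simp: simple_graph_def)
  define d where "d v = (LEAST k. (E ^^ k) r v)" for v
  have reach: "(E ^^ d v) r v" if v: "v < n" for v
  proof -
    have "E\<^sup>*\<^sup>* r v" using conn r v by (simp add: connected_graph_def)
    then obtain k where "(E ^^ k) r v" by (auto dest: rtranclp_imp_relpowp)
    then show ?thesis unfolding d_def by (rule LeastI)
  qed
  have d_le: "d v \<le> k" if "(E ^^ k) r v" for k v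
    unfolding d_def using that by (rule Least_le)
  \<comment> \<open>The last vertex but one on a shortest walk from \<open>r\<close> to
    \<open>v\<close> is nearer to \<open>r\<close> by exactly one; such a vertex becomes the
    parent.\<close>
  have "\<exists>w. E v w \<and> d v = Suc (d w)" if v: "v < n" "v \<noteq> r" for v
  proof -
    have "d v \<noteq> 0" using reach[OF v(1)] v(2) by (intro notI) simp
    then obtain k where k: "d v = Suc k" by (cases "d v") auto
    then obtain w where w: "(E ^^ k) r w" "E w v" using reach[OF v(1)] by (auto elim: relpowp_Suc_E)
    have "w < n" using w bd by blast
    have "(E ^^ Suc (d w)) r v" using reach[OF \<open>w < n\<close>] w(2) by (rule relpowp_Suc_I)
    then have "d v \<le> Suc (d w)" by (rule d_le)
    then have "d w = k" using d_le[OF w(1)] k by simp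
    then show ?thesis using w(2) sym k by auto
  qed
  then obtain p where p: "\<And>v. v < n \<Longrightarrow> v \<noteq> r \<Longrightarrow> E v (p v) \<and> d v = Suc (d (p v))" by metis
  define f where "f v = {v, p v}" for v
  have "inj_on f ({..<n} - {r})"
  proof (rule inj_onI)
    fix u v assume uv: "u \<in> {..<n} - {r}" "v \<in> {..<n} - {r}" "f u = f v"
    show "u = v"
    proof (rule ccontr)
      assume "u \<noteq> v"
      then have *: "p v = u" "p u = v" using uv(3) unfolding f_def doubleton_eq_iff by metis+
      have "d u = Suc (d (p u))" "d v = Suc (d (p v))" using p uv(1,2) by simp_all
      then show False unfolding * by simp
    qed
  qed
  then have "card (f ` ({..<n} - {r})) = n - 1" using r by (simp add: card_image)
  moreover have "f ` ({..<n} - {r}) \<subseteq> edge_set n E"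
  proof
    fix e assume "e \<in> f ` ({..<n} - {r})"
    then obtain v where v: "e = f v" "v < n" "v \<noteq> r" by auto
    have e: "E v (p v)" using p[OF v(2,3)] by simp
    show "e \<in> edge_set n E"
      unfolding edge_set_def mem_Collect_eq v(1) f_def
      by (intro exI[of _ v] exI[of _ "p v"] conjI refl e) (use bd[OF e] in simp_all)
  qed
  moreover have "finite (edge_set n E)"
    by (rule finite_subset[of _ "Pow {..<n}"]) (auto simp: edge_set_def)
  ultimately have surj: "f ` ({..<n} - {r}) = edge_set n E"
    using ce by (intro card_subset_eq) auto
  have "rooted_tree n E r p d"
  proof
    fix u v assume uv: "E u v"
    have "{u, v} \<in> f ` ({..<n} - {r})"
      unfolding surj edge_set_def mem_Collect_eq
      by (intro exI[of _ u] exI[of _ v] conjI refl uv) (use bd[OF uv] in simp_all)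
    then obtain w where "w \<noteq> r" "{u, v} = {w, p w}" by (auto simp: f_def)
    then show "(u \<noteq> r \<and> p u = v) \<or> (v \<noteq> r \<and> p v = u)" by (auto simp: doubleton_eq_iff)
  qed (use G r p in auto)
  then show ?thesis by (rule that)
qed

context rooted_tree
begin

lemma edge_sym: "E u v \<Longrightarrow> E v u"
  and edge_irrefl: "\<not> E v v"
  and edge_less: "E u v \<Longrightarrow> u < n" "E u v \<Longrightarrow> v < n"
  using simple by (auto simp: simple_graph_def)

lemma root_edge: "E v r \<Longrightarrow> v \<noteq> r \<and> parent v = r"
  using edge_parent by blast

lemma child: "E v u \<Longrightarrow> v = r \<or> u \<noteq> parent v \<Longrightarrow> u \<noteq> r \<and> parent u = v \<and> depth u = Suc (depth v)"
  using edge_parent[of v u] depth_parent[of u] edge_less[of v u] by auto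

text \<open>Induction from the deepest vertices upwards. A leaf \<open>v\<close> hangs at a
  quasi-pendant vertex other than the root, so it is zero. Any other \<open>v\<close> has a child
  \<open>c\<close>; as \<open>c\<close> and all children of \<open>c\<close> are already zero, the
  equation at \<open>c\<close> forces \<open>v\<close>. The leaves at the root are exempt because
  nothing is assumed about the root.\<close>

lemma lap_eigenfun_zero_below_root:
  assumes x: "lap_eigenfun n E \<mu> x" and \<mu>: "\<mu> \<noteq> 1"
    and Q: "\<And>w. w \<in> quasi_pendants E \<Longrightarrow> w \<noteq> r \<Longrightarrow> x w = 0"
    and "v < n" "v \<noteq> r" "\<not> pendant E v r"
  shows "x v = 0"
  using assms(4-6)
proof (induction "Max (depth ` {..<n}) - depth v" arbitrary: v rule: less_induct)
  case less
  \<comment> \<open>Here \<open>v'\<close> is \<open>v\<close> or a child of \<open>v\<close>, so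
    children and grandchildren of \<open>v\<close> are both covered. None of them hangs at the root,
    since their parent \<open>v'\<close> is not the root.\<close>
  have IH: "x c = 0" if "E v' c" "v' = v \<or> parent v' = v \<and> v' \<noteq> r \<and> v' < n" "c \<noteq> parent v'" for v' c
  proof -
    have c: "c \<noteq> r" "parent c = v'" "depth c = Suc (depth v')" using child[OF that(1)] that(3) by blast+
    have "c < n" "v' \<noteq> r" using edge_less(2)[OF that(1)] that(2) less.prems by blast+
    then have "\<not> pendant E c r" using c edge_sym[OF that(1)] by (auto simp: pendant_def)
    moreover have "depth v \<le> depth v'" using that(2) depth_parent[of v'] by fastforce
    moreover have "depth c \<le> Max (depth ` {..<n})" using \<open>c < n\<close> by simp
    ultimately show ?thesis using c(1,3) \<open>c < n\<close> less.hyps[of c] by simp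
  qed
  show ?case
  proof (cases "pendant E v (parent v)")
    case True
    then have "parent v \<noteq> r" using less.prems by auto
    moreover have "parent v \<in> quasi_pendants E" using True by (auto simp: quasi_pendants_def)
    ultimately have "x (parent v) = 0" using Q by blast
    then show ?thesis using lap_eigenfun_pendant_zero_iff[OF simple x True \<mu>] by simp
  next
    case False
    then obtain c where c: "E v c" "c \<noteq> parent v"
      using parent_edge[of v] less.prems by (auto simp: pendant_def)
    have pc: "parent c = v" "c \<noteq> r" using child[OF c(1)] c(2) by auto
    show ?thesis
    proof (rule lap_eigenfun_force[OF simple x _ edge_sym[OF c(1)]])
      show "x c = 0" using IH[OF c(1)] c(2) by simp
      show "x w = 0" if "E c w" "w \<noteq> v" for w
        using IH[OF that(1)] pc that(2) edge_less[OF c(1)] by simp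
    qed
  qed
qed

lemma lap_eigenfun_zero:
  assumes x: "lap_eigenfun n E \<mu> x" and \<mu>: "\<mu> \<noteq> 1"
    and Q: "\<And>w. w \<in> quasi_pendants E \<Longrightarrow> w \<noteq> r \<Longrightarrow> x w = 0" and r0: "x r = 0"
    and v: "v < n"
  shows "x v = 0"
  using lap_eigenfun_zero_below_root[OF x \<mu> Q v] lap_eigenfun_pendant_zero_iff[OF simple x _ \<mu>] r0
  by blast

text \<open>The equation at a neighbour \<open>c\<close> that is not a leaf involves, besides the
  root, only vertices known to be zero. This allows one quasi-pendant vertex, taken as the root, to
  be omitted.\<close>

lemma lap_eigenfun_zero_root:
  assumes x: "lap_eigenfun n E \<mu> x" and \<mu>: "\<mu> \<noteq> 1"
    and Q: "\<And>w. w \<in> quasi_pendants E \<Longrightarrow> w \<noteq> r \<Longrightarrow> x w = 0"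
    and c: "E c r" "\<not> pendant E c r"
  shows "x r = 0"
proof (rule lap_eigenfun_force[OF simple x _ c(1)])
  have cr: "c \<noteq> r" "parent c = r" using root_edge[OF c(1)] by auto
  show "x c = 0" using lap_eigenfun_zero_below_root[OF x \<mu> Q _ _ c(2)] cr edge_less[OF c(1)] by blast
  fix w assume w: "E c w" "w \<noteq> r"
  then have "\<not> pendant E w r" using edge_sym[of c w] cr by (auto simp: pendant_def)
  then show "x w = 0" using lap_eigenfun_zero_below_root[OF x \<mu> Q _ w(2)] edge_less[OF w(1)] by blast
qed

lemma root_neighbours_pendant_imp_star:
  assumes "\<And>c. E c r \<Longrightarrow> pendant E c r" and "v < n" "v \<noteq> r"
  shows "parent v = r"
  using assms(2,3)
proof (induction "depth v" arbitrary: v rule: less_induct)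
  case less
  show ?case
  proof (rule ccontr)
    assume *: "parent v \<noteq> r"
    have e: "E v (parent v)" using parent_edge less.prems by blast
    have "parent (parent v) = r"
      using less.hyps[of "parent v"] * depth_parent[of v] less.prems edge_less[OF e] by simp
    then have "E (parent v) r" using parent_edge[of "parent v"] * edge_less[OF e] by simp
    then have "pendant E (parent v) r" by (rule assms(1))
    then show False using edge_sym[OF e] less.prems by (auto simp: pendant_def)
  qed
qed

end

text \<open>Otherwise the only neighbour of \<open>w\<close> is itself a leaf; with \<open>w\<close>
  as root the tree is then a star around \<open>w\<close>, hence a single edge.\<close>

lemma quasi_pendant_not_pendant:
  assumes T: "is_tree n E" and n: "n \<ge> 3" and w: "w \<in> quasi_pendants E"
  shows "\<not> pendant E w u"
proof
  assume wu: "pendant E w u"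
  obtain l where l: "pendant E l w" using w by (auto simp: quasi_pendants_def)
  have G: "simple_graph n E" using T by (simp add: is_tree_def)
  have "w < n" "E w l" using l G by (auto simp: pendant_def simple_graph_def)
  obtain p d where "rooted_tree n E w p d" using tree_rooted[OF T \<open>w < n\<close>] .
  then interpret rooted_tree n E w p d .
  have ul: "u = l" using wu \<open>E w l\<close> by (auto simp: pendant_def)
  have "v = l" if v: "v < n" "v \<noteq> w" for v
  proof -
    have "p v = w"
    proof (rule root_neighbours_pendant_imp_star[OF _ v])
      fix c assume "E c w"
      then have "c = u" using wu edge_sym unfolding pendant_def by blast
      then show "pendant E c w" using ul l by simp
    qed
    then have "E w v" using parent_edge[OF v] edge_sym by simp
    then show ?thesis using wu ul unfolding pendant_def by blast
  qed
  then have "{..<n} \<subseteq> {w, l}" by auto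
  then have "card {..<n} \<le> card {w, l}" by (intro card_mono) auto
  also have "\<dots> \<le> 2" by (simp add: card_insert_if)
  finally show False using n by simp
qed

lemma quasi_pendants_less:
  assumes "simple_graph n E"
  shows "quasi_pendants E \<subseteq> {..<n}"
  using assms by (auto simp: quasi_pendants_def pendant_def simple_graph_def)

text \<open>The root \<open>w\<close> needs a neighbour that is not a leaf. If there were none, the
  tree would be a star with centre \<open>w\<close>, and a second quasi-pendant vertex
  \<open>u\<close> would be a leaf.\<close>

lemma lap_mult_le_quasi_pendants:
  assumes T: "is_tree n E" and n: "n \<ge> 3" and \<mu>: "\<mu> \<noteq> 1"
    and q: "card (quasi_pendants E) \<ge> 2"
  shows "lap_mult n E \<mu> \<le> card (quasi_pendants E) - 1"
proof -
  have G: "simple_graph n E" using T by (simp add: is_tree_def)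
  let ?Q = "quasi_pendants E"
  have fin: "finite ?Q" using quasi_pendants_less[OF G] finite_subset by blast
  have "\<not> card ?Q \<le> Suc 0" using q by simp
  then obtain w u where wu: "w \<in> ?Q" "u \<in> ?Q" "u \<noteq> w"
    unfolding card_le_Suc0_iff_eq[OF fin] by blast
  have wn: "w < n" "u < n" using wu quasi_pendants_less[OF G] by auto
  obtain p d where "rooted_tree n E w p d" using tree_rooted[OF T wn(1)] .
  then interpret rooted_tree n E w p d .
  have "\<exists>c. E c w \<and> \<not> pendant E c w"
  proof (rule ccontr)
    assume "\<not> (\<exists>c. E c w \<and> \<not> pendant E c w)"
    then have all: "\<And>c. E c w \<Longrightarrow> pendant E c w" by blast
    then have "p u = w" using root_neighbours_pendant_imp_star[OF _ wn(2)] wu by blast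
    then have "pendant E u w" using all parent_edge[OF wn(2)] wu by auto
    then show False using quasi_pendant_not_pendant[OF T n wu(2)] by blast
  qed
  then obtain c where c: "E c w" "\<not> pendant E c w" by blast
  have "lap_mult n E \<mu> \<le> card (?Q - {w})"
  proof (rule lap_mult_le_card[OF G])
    fix x assume x: "lap_eigenfun n E \<mu> x" and x0: "\<forall>v\<in>?Q - {w}. x v = 0"
    then have Q0: "\<And>u. u \<in> ?Q \<Longrightarrow> u \<noteq> w \<Longrightarrow> x u = 0" by blast
    show "\<forall>v<n. x v = 0"
      using lap_eigenfun_zero[OF x \<mu> Q0 lap_eigenfun_zero_root[OF x \<mu> Q0 c]] by simp
  qed (use fin in auto)
  then show ?thesis using wu fin by simp
qed

lemma lap_mult_le_1_of_quasi_pendants: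
  assumes T: "is_tree n E" and \<mu>: "\<mu> \<noteq> 1" and q: "card (quasi_pendants E) \<le> 1"
  shows "lap_mult n E \<mu> \<le> 1"
proof -
  have G: "simple_graph n E" and n: "0 < n" using T by (auto simp: is_tree_def)
  let ?Q = "quasi_pendants E"
  have fin: "finite ?Q" using quasi_pendants_less[OF G] finite_subset by blast
  \<comment> \<open>\<open>?Q\<close> is empty for the one-vertex tree; any root serves
    then.\<close>
  obtain w where w: "?Q \<subseteq> {w}" "w < n"
  proof (cases "?Q = {}")
    case True
    then show ?thesis using that[of 0] n by simp
  next
    case False
    then obtain w where "w \<in> ?Q" by blast
    moreover have "?Q \<subseteq> {w}" using q fin \<open>w \<in> ?Q\<close> by (auto simp: card_le_Suc0_iff_eq)
    ultimately show ?thesis using that quasi_pendants_less[OF G] by blast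
  qed
  obtain p d where "rooted_tree n E w p d" using tree_rooted[OF T w(2)] .
  then interpret rooted_tree n E w p d .
  have "lap_mult n E \<mu> \<le> card {w}"
  proof (rule lap_mult_le_card[OF G])
    fix x assume x: "lap_eigenfun n E \<mu> x" and x0: "\<forall>v\<in>{w}. x v = 0"
    have Q0: "\<And>u. u \<in> ?Q \<Longrightarrow> u \<noteq> w \<Longrightarrow> x u = 0" using w(1) by blast
    show "\<forall>v<n. x v = 0"
      using lap_eigenfun_zero[OF x \<mu> Q0] x0 by simp
  qed auto
  then show ?thesis by simp
qed

text \<open>The source of \<open>2 q \<le> n\<close>: one leaf is chosen for each quasi-pendant
  vertex. A leaf has only one neighbour, so the choice is injective, and no vertex is of both
  kinds.\<close>

lemma quasi_pendant_leaves:
  assumes T: "is_tree n E" and n: "n \<ge> 3"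
  obtains leaf where "\<And>w. w \<in> quasi_pendants E \<Longrightarrow> pendant E (leaf w) w"
    "inj_on leaf (quasi_pendants E)" "leaf ` quasi_pendants E \<inter> quasi_pendants E = {}"
    "quasi_pendants E \<union> leaf ` quasi_pendants E \<subseteq> {..<n}"
    "card (quasi_pendants E \<union> leaf ` quasi_pendants E) = 2 * card (quasi_pendants E)"
proof -
  have G: "simple_graph n E" using T by (simp add: is_tree_def)
  let ?Q = "quasi_pendants E"
  have fin: "finite ?Q" using quasi_pendants_less[OF G] finite_subset by blast
  define leaf where "leaf w = (SOME l. pendant E l w)" for w
  have leaf: "pendant E (leaf w) w" if "w \<in> ?Q" for w
    using that someI_ex[of "\<lambda>l. pendant E l w"] by (simp add: leaf_def quasi_pendants_def)
  have inj: "inj_on leaf ?Q"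
  proof (rule inj_onI)
    fix u w assume "u \<in> ?Q" "w \<in> ?Q" "leaf u = leaf w"
    then show "u = w" using leaf[of u] leaf[of w] by (auto simp: pendant_def)
  qed
  have disj: "leaf ` ?Q \<inter> ?Q = {}"
    using leaf quasi_pendant_not_pendant[OF T n] by blast
  have sub: "?Q \<union> leaf ` ?Q \<subseteq> {..<n}"
  proof -
    have "leaf w < n" if "w \<in> ?Q" for w
      using leaf[OF that] G unfolding pendant_def simple_graph_def by blast
    then show ?thesis using quasi_pendants_less[OF G] by auto
  qed
  have "card (?Q \<union> leaf ` ?Q) = 2 * card ?Q"
    using inj disj fin by (subst card_Un_disjoint) (auto simp: card_image)
  then show ?thesis by (intro that[of leaf]) (use leaf inj disj sub in auto)
qed

section \<open>Trees with few extra vertices\<close>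

text \<open>Rooted at \<open>a\<close>, both \<open>b\<close> and \<open>c\<close> have parent
  \<open>a\<close>, so neither is the parent of the other. Later this keeps a second unknown value
  out of the equation by which a zero is passed on.\<close>

lemma tree_no_triangle:
  assumes T: "is_tree n E" and "E a b" "E b c" "E a c"
  shows False
proof -
  have "a < n" using assms(2) T by (auto simp: is_tree_def simple_graph_def)
  obtain p d where "rooted_tree n E a p d" using tree_rooted[OF T \<open>a < n\<close>] .
  then interpret rooted_tree n E a p d .
  have "p b = a" "p c = a" using root_edge edge_sym assms(2,4) by blast+
  moreover have "p b = c \<or> p c = b" using edge_parent[OF assms(3)] by blast
  ultimately show False using assms(2,4) edge_irrefl by auto
qed

text \<open>Rooted at \<open>z\<close>, both \<open>b\<close> and \<open>c\<close> have parent
  \<open>z\<close>, so \<open>a\<close> would need both of them as its parent.\<close>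

lemma tree_no_square:
  assumes T: "is_tree n E" and "E z b" "E z c" "E a b" "E a c" and "a \<noteq> z" "b \<noteq> c"
  shows False
proof -
  have "z < n" using assms(2) T by (auto simp: is_tree_def simple_graph_def)
  obtain p d where "rooted_tree n E z p d" using tree_rooted[OF T \<open>z < n\<close>] .
  then interpret rooted_tree n E z p d .
  have "p b = z" "p c = z" using root_edge edge_sym assms(2,3) by blast+
  then show False using edge_parent[OF assms(4)] edge_parent[OF assms(5)] assms(6,7) by auto
qed

lemma is_tree_simple: "is_tree n E \<Longrightarrow> simple_graph n E"
  by (simp add: is_tree_def)

lemma finite_quasi_pendants: "simple_graph n E \<Longrightarrow> finite (quasi_pendants E)"
  using quasi_pendants_less finite_subset by blast

lemma lap_mult_le_card_Diff2:
  assumes G: "simple_graph n E" and Q: "finite Q" "b \<in> Q" "c \<in> Q" "b \<noteq> c"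
    and forcing: "\<And>x. lap_eigenfun n E \<mu> x \<Longrightarrow> (\<And>v. v \<in> Q \<Longrightarrow> v \<noteq> b \<Longrightarrow> v \<noteq> c \<Longrightarrow> x v = 0) \<Longrightarrow>
      \<forall>v<n. x v = 0"
  shows "lap_mult n E \<mu> + 2 \<le> card Q"
proof -
  have "lap_mult n E \<mu> \<le> card (Q - {b, c})"
  proof (rule lap_mult_le_card[OF G])
    fix x assume x: "lap_eigenfun n E \<mu> x" and x0: "\<forall>v\<in>Q - {b, c}. x v = 0"
    show "\<forall>v<n. x v = 0" by (rule forcing[OF x]) (use x0 in blast)
  qed (use Q in simp)
  moreover have "card (Q - {b, c}) = card Q - 2" using Q by (simp add: card_Diff_subset)
  moreover have "card {b, c} \<le> card Q" using Q by (intro card_mono) auto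
  ultimately show ?thesis using Q(4) by simp
qed

text \<open>The tree is a subtree on the quasi-pendant vertices with leaves attached to each of
  them. On a path \<open>a\<close>, \<open>b\<close>, \<open>c\<close> in this subtree the equation
  at \<open>a\<close> forces \<open>b\<close>, and then the equation at \<open>b\<close> forces
  \<open>c\<close>. Three quasi-pendant vertices guarantee such a path.\<close>

lemma lap_mult_le_of_corona:
  assumes T: "is_tree n E" and \<mu>: "\<mu> \<noteq> 1"
    and q: "card (quasi_pendants E) \<ge> 3"
    and cover: "\<And>v. v < n \<Longrightarrow> v \<in> quasi_pendants E \<or> (\<exists>w. pendant E v w)"
  shows "lap_mult n E \<mu> + 2 \<le> card (quasi_pendants E)"
proof -
  let ?Q = "quasi_pendants E"
  note G = is_tree_simple[OF T]
  note fin = finite_quasi_pendants[OF G]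
  have sym: "E u v \<Longrightarrow> E v u" and bd: "E u v \<Longrightarrow> u < n" for u v
    using G by (auto simp: simple_graph_def)
  have nonleaf: "v \<in> ?Q" if "E v u" "E v w" "u \<noteq> w" for u v w
    using cover[OF bd[OF that(1)]] that by (auto simp: pendant_def)
  \<comment> \<open>If some \<open>u\<close> lies at least two levels below the root, the path
    climbs from \<open>u\<close>; the vertices above \<open>u\<close>, other than the root, have two
    neighbours and so are not leaves. Otherwise two quasi-pendant children of \<open>r\<close> are
    joined through \<open>r\<close>.\<close>
  obtain a b c where abc: "E a b" "E b c" "a \<noteq> c" "a \<in> ?Q" "b \<in> ?Q" "c \<in> ?Q"
  proof -
    have "?Q \<noteq> {}" using q by auto
    then obtain r where r: "r \<in> ?Q" by blast
    then have "r < n" using quasi_pendants_less[OF G] by auto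
    obtain p d where "rooted_tree n E r p d" using tree_rooted[OF T \<open>r < n\<close>] .
    then interpret rooted_tree n E r p d .
    show ?thesis
    proof (cases "\<exists>u\<in>?Q. u \<noteq> r \<and> p u \<noteq> r")
      case True
      then obtain u where u: "u \<in> ?Q" "u \<noteq> r" "p u \<noteq> r" by blast
      then have un: "u < n" using quasi_pendants_less[OF G] by auto
      have e1: "E u (p u)" using parent_edge[OF un u(2)] .
      have e2: "E (p u) (p (p u))" using parent_edge[OF edge_less(2)[OF e1] u(3)] .
      have d1: "d u = Suc (d (p u))" "d (p u) = Suc (d (p (p u)))"
        using depth_parent[OF un u(2)] depth_parent[OF edge_less(2)[OF e1] u(3)] by auto
      then have ne: "u \<noteq> p (p u)" by auto
      have bQ: "p u \<in> ?Q" using nonleaf[OF edge_sym[OF e1] e2] ne by blast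
      have "p (p u) \<in> ?Q"
      proof (cases "p (p u) = r")
        case False
        have "E (p (p u)) (p (p (p u)))" using parent_edge[OF edge_less(2)[OF e2] False] .
        moreover have "p u \<noteq> p (p (p u))"
        proof
          assume "p u = p (p (p u))"
          then have "d (p u) = d (p (p (p u)))" by (rule arg_cong)
          then show False using depth_parent[OF edge_less(2)[OF e2] False] d1(2) by linarith
        qed
        ultimately show ?thesis using nonleaf[OF edge_sym[OF e2]] by blast
      qed (use r in simp)
      then show ?thesis using that[OF e1 e2 ne u(1) bQ] by blast
    next
      case False
      have "\<not> card (?Q - {r}) \<le> Suc 0" using q r fin by simp
      then obtain u w where uw: "u \<in> ?Q - {r}" "w \<in> ?Q - {r}" "u \<noteq> w"
        using fin by (subst (asm) card_le_Suc0_iff_eq) auto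
      then have "u < n" "w < n" using quasi_pendants_less[OF G] by auto
      then have "E u (p u)" "E w (p w)" using parent_edge uw by auto
      moreover have "p u = r" "p w = r" using False uw by auto
      ultimately have "E u r" "E r w" using edge_sym by auto
      then show ?thesis using that[of u r w] uw r by auto
    qed
  qed
  have ac: "\<not> E a c" using tree_no_triangle[OF T abc(1,2)] by blast
  have bc: "b \<noteq> c" using abc(2) G by (auto simp: simple_graph_def)
  have ab: "a \<noteq> b" using abc(1) G by (auto simp: simple_graph_def)
  show ?thesis
  proof (rule lap_mult_le_card_Diff2[OF G fin abc(5,6) bc])
    fix x assume x: "lap_eigenfun n E \<mu> x"
      and x0: "\<And>v. v \<in> ?Q \<Longrightarrow> v \<noteq> b \<Longrightarrow> v \<noteq> c \<Longrightarrow> x v = 0"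
    have pend: "x l = 0" if "pendant E l w" "x w = 0" for l w
      using lap_eigenfun_pendant_zero_iff[OF G x that(1) \<mu>] that(2) by simp
    \<comment> \<open>A neighbour of the zero \<open>v\<close> that is not quasi-pendant is a leaf
      hanging at \<open>v\<close>, hence zero as well.\<close>
    have nb: "x w = 0" if vw: "E v w" "x v = 0" and Qw: "w \<in> ?Q \<Longrightarrow> x w = 0" for v w
    proof -
      consider "w \<in> ?Q" | u where "pendant E w u" using cover[OF bd[OF sym[OF vw(1)]]] by blast
      then show ?thesis
      proof cases
        case (2 u)
        then have "u = v" using sym[OF vw(1)] by (auto simp: pendant_def)
        then show ?thesis using pend[OF 2] vw(2) by blast
      qed (use Qw in blast)
    qed
    have xa: "x a = 0" using x0 abc ab by blast
    have xb: "x b = 0"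
    proof (rule lap_eigenfun_force[OF G x xa abc(1)])
      fix w assume w: "E a w" "w \<noteq> b"
      then have "w \<noteq> c" using ac by blast
      then show "x w = 0" using nb[OF w(1) xa] x0[of w] w(2) by blast
    qed
    have xc: "x c = 0"
    proof (rule lap_eigenfun_force[OF G x xb abc(2)])
      fix w assume w: "E b w" "w \<noteq> c"
      have "w \<noteq> b" using w(1) G by (auto simp: simple_graph_def)
      then show "x w = 0" using nb[OF w(1) xb] x0[of w] w(2) by blast
    qed
    have "x v = 0" if "v \<in> ?Q" for v using x0[OF that] xb xc by blast
    then have "x v = 0" if "v < n" for v
      using cover[OF that] pend pendant_quasi_pendants by blast
    then show "\<forall>v<n. x v = 0" by blast
  qed
qed

text \<open>A quasi-pendant vertex not adjacent to \<open>z\<close> yields a path \<open>a\<close>,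
  \<open>b\<close>, \<open>z\<close>, \<open>c\<close> on which \<open>b\<close>, \<open>z\<close>
  and \<open>c\<close> carry the unknown values. The equations at \<open>a\<close>, \<open>b\<close>
  and \<open>z\<close> force them in this order.\<close>

lemma lap_mult_le_of_extra_vertex:
  assumes T: "is_tree n E" and \<mu>: "\<mu> \<noteq> 1"
    and z: "z < n" "z \<notin> quasi_pendants E" "\<And>w. \<not> pendant E z w"
    and cover: "\<And>v. v < n \<Longrightarrow> v \<noteq> z \<Longrightarrow> v \<in> quasi_pendants E \<or> (\<exists>w. pendant E v w)"
    and far: "u \<in> quasi_pendants E" "\<not> E u z"
  shows "lap_mult n E \<mu> + 2 \<le> card (quasi_pendants E)"
proof -
  let ?Q = "quasi_pendants E"
  note G = is_tree_simple[OF T]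
  note fin = finite_quasi_pendants[OF G]
  have sym: "E u v \<Longrightarrow> E v u" and bd: "E u v \<Longrightarrow> u < n" and irr: "\<not> E u u" for u v
    using G by (auto simp: simple_graph_def)
  have nonleaf: "v \<in> ?Q" if "E v u" "E v w" "u \<noteq> w" "v \<noteq> z" for u v w
    using cover[OF bd[OF that(1)]] that by (auto simp: pendant_def)
  obtain a b where ab: "a \<in> ?Q" "b \<in> ?Q" "E a b" "E b z" "\<not> E a z"
  proof -
    obtain p d where "rooted_tree n E z p d" using tree_rooted[OF T z(1)] .
    then interpret rooted_tree n E z p d .
    \<comment> \<open>Chosen as near to \<open>z\<close> as possible: its parent is quasi-pendant
      and nearer, and therefore adjacent to \<open>z\<close>.\<close>
    obtain a where a: "a \<in> ?Q \<and> \<not> E a z"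
      and min: "\<And>v. v \<in> ?Q \<and> \<not> E v z \<Longrightarrow> d a \<le> d v"
    proof -
      have "\<exists>a. (a \<in> ?Q \<and> \<not> E a z) \<and> (\<forall>v. v \<in> ?Q \<and> \<not> E v z \<longrightarrow> d a \<le> d v)"
        by (rule ex_has_least_nat[of _ u]) (use far in simp)
      then show ?thesis using that by blast
    qed
    have an: "a < n" "a \<noteq> z" using a z quasi_pendants_less[OF G] by auto
    have e1: "E a (p a)" using parent_edge[OF an] .
    have pz: "p a \<noteq> z" using e1 a by auto
    have e2: "E (p a) (p (p a))" using parent_edge[OF edge_less(2)[OF e1] pz] .
    have d1: "d a = Suc (d (p a))" "d (p a) = Suc (d (p (p a)))"
      using depth_parent[OF an] depth_parent[OF edge_less(2)[OF e1] pz] by auto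
    have "a \<noteq> p (p a)" using d1 by auto
    then have bQ: "p a \<in> ?Q" using nonleaf[OF edge_sym[OF e1] e2 _ pz] by blast
    moreover have "E (p a) z" using min[of "p a"] bQ d1 by auto
    ultimately show ?thesis using that[of a "p a"] a e1 by blast
  qed
  have az: "a \<noteq> z" using ab(1) z(2) by blast
  \<comment> \<open>As \<open>z\<close> is not a leaf it has a second neighbour, which is no leaf
    either, since \<open>z\<close> carries none.\<close>
  obtain c where c: "E z c" "c \<noteq> b" using z(3)[of b] sym[OF ab(4)] by (auto simp: pendant_def)
  have cz: "c \<noteq> z" using c(1) irr by blast
  have cQ: "c \<in> ?Q"
  proof (rule ccontr)
    assume "c \<notin> ?Q"
    then obtain w where "pendant E c w" using cover[OF bd[OF sym[OF c(1)]] cz] by blast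
    then show False using sym[OF c(1)] z(2) unfolding pendant_def quasi_pendants_def by blast
  qed
  \<comment> \<open>Otherwise \<open>c\<close> would be a second unknown in the equation at
    \<open>a\<close> or \<open>b\<close>.\<close>
  have ac: "\<not> E a c" using tree_no_square[OF T sym[OF ab(4)] c(1) ab(3) _ az] c(2) by blast
  have bc: "\<not> E b c" using tree_no_triangle[OF T sym[OF ab(4)] _ c(1)] by blast
  have aa: "a \<noteq> b" "a \<noteq> c" using ab(3,5) sym[OF c(1)] irr by auto
  show ?thesis
  proof (rule lap_mult_le_card_Diff2[OF G fin ab(2) cQ c(2)[symmetric]])
    fix x assume x: "lap_eigenfun n E \<mu> x"
      and x0: "\<And>v. v \<in> ?Q \<Longrightarrow> v \<noteq> b \<Longrightarrow> v \<noteq> c \<Longrightarrow> x v = 0"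
    have pend: "x l = 0" if "pendant E l w" "x w = 0" for l w
      using lap_eigenfun_pendant_zero_iff[OF G x that(1) \<mu>] that(2) by simp
    have nb: "x w = 0" if vw: "E v w" "x v = 0" "w \<noteq> z" and Qw: "w \<in> ?Q \<Longrightarrow> x w = 0" for v w
    proof -
      consider "w \<in> ?Q" | u where "pendant E w u" using cover[OF bd[OF sym[OF vw(1)]] vw(3)] by blast
      then show ?thesis
      proof cases
        case (2 u)
        then have "u = v" using sym[OF vw(1)] by (auto simp: pendant_def)
        then show ?thesis using pend[OF 2] vw(2) by blast
      qed (use Qw in blast)
    qed
    have xa: "x a = 0" using x0 ab aa by blast
    have xb: "x b = 0"
    proof (rule lap_eigenfun_force[OF G x xa ab(3)])
      fix w assume w: "E a w" "w \<noteq> b"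
      then have "w \<noteq> c" "w \<noteq> z" using ac ab(5) by auto
      then show "x w = 0" using nb[OF w(1) xa] x0[of w] w(2) by blast
    qed
    have xz: "x z = 0"
    proof (rule lap_eigenfun_force[OF G x xb ab(4)])
      fix w assume w: "E b w" "w \<noteq> z"
      then have "w \<noteq> c" "w \<noteq> b" using bc irr by auto
      then show "x w = 0" using nb[OF w(1) xb w(2)] x0[of w] by blast
    qed
    have xc: "x c = 0"
    proof (rule lap_eigenfun_force[OF G x xz c(1)])
      fix w assume w: "E z w" "w \<noteq> c"
      then have "w \<noteq> z" using irr by auto
      then show "x w = 0" using nb[OF w(1) xz] x0[of w] w(2) xb by blast
    qed
    have Q0: "x v = 0" if "v \<in> ?Q" for v using x0[OF that] xb xc by blast
    have "x v = 0" if "v < n" for v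
    proof (cases "v = z")
      case False
      show ?thesis using cover[OF that False] pend Q0 pendant_quasi_pendants by blast
    qed (use xz in simp)
    then show "\<forall>v<n. x v = 0" by blast
  qed
qed

section \<open>Recognition of the spider, and invariance of the spectrum under isomorphism\<close>

lemma graph_iso_sym:
  assumes "graph_iso m F n E"
  shows "graph_iso n E m F"
proof -
  obtain f where f: "bij_betw f {0..<m} {0..<n}"
    and edge: "\<And>u v. u < m \<Longrightarrow> v < m \<Longrightarrow> F u v \<longleftrightarrow> E (f u) (f v)"
    using assms by (auto simp: graph_iso_def)
  let ?g = "inv_into {0..<m} f"
  have g: "bij_betw ?g {0..<n} {0..<m}" using f by (rule bij_betw_inv_into)
  have fg: "f (?g v) = v" "?g v < m" if "v < n" for v
    using bij_betw_inv_into_right[OF f] bij_betwE[OF g] that by auto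
  have "E u v \<longleftrightarrow> F (?g u) (?g v)" if "u < n" "v < n" for u v
    using edge[of "?g u" "?g v"] fg[OF that(1)] fg[OF that(2)] by simp
  then show ?thesis using g by (auto simp: graph_iso_def)
qed

text \<open>\<open>z\<close>, the quasi-pendant vertices and one leaf of each account for all
  \<open>2 q + 1\<close> vertices, so each leg ends in exactly one leaf. Two adjacent quasi-pendant
  vertices would form a triangle with \<open>z\<close>.\<close>

lemma graph_iso_spider:
  assumes T: "is_tree n E" and n: "n \<ge> 3"
    and z: "z < n" "z \<notin> quasi_pendants E" "\<And>w. \<not> pendant E z w"
    and n_eq: "n = 2 * card (quasi_pendants E) + 1"
    and near: "\<And>u. u \<in> quasi_pendants E \<Longrightarrow> E u z"
  shows "graph_iso n E (spider_order (card (quasi_pendants E)) (card (quasi_pendants E)))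
           (spider_edge (card (quasi_pendants E)) (card (quasi_pendants E)))"
proof -
  let ?Q = "quasi_pendants E"
  define q where "q = card ?Q"
  note G = is_tree_simple[OF T]
  note fin = finite_quasi_pendants[OF G]
  have sym: "E u v \<Longrightarrow> E v u" and irr: "\<not> E u u" for u v
    using G by (auto simp: simple_graph_def)
  obtain leaf where leaf: "\<And>w. w \<in> ?Q \<Longrightarrow> pendant E (leaf w) w"
    and inj: "inj_on leaf ?Q" and disj: "leaf ` ?Q \<inter> ?Q = {}"
    and sub: "?Q \<union> leaf ` ?Q \<subseteq> {..<n}" and card: "card (?Q \<union> leaf ` ?Q) = 2 * card ?Q"
    using quasi_pendant_leaves[OF T n] by blast
  have znot: "z \<notin> ?Q \<union> leaf ` ?Q" using z leaf by blast
  have V: "insert z (?Q \<union> leaf ` ?Q) = {..<n}"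
    using sub znot z(1) fin by (intro card_subset_eq) (auto simp: card n_eq)
  have leaf_edge: "E (leaf w) v \<longleftrightarrow> v = w" if "w \<in> ?Q" for w v
    using leaf[OF that] by (auto simp: pendant_def)
  have edge_leaf: "E v (leaf w) \<longleftrightarrow> v = w" if "w \<in> ?Q" for w v
    using leaf_edge[OF that] sym by blast
  have QQ: "\<not> E u v" if "u \<in> ?Q" "v \<in> ?Q" for u v
    using tree_no_triangle[OF T _ near[OF that(2)] near[OF that(1)]] by blast
  obtain g where g: "bij_betw g {1..q} ?Q"
    using ex_bij_betw_nat_finite_1[OF fin] unfolding q_def by blast
  have gQ: "g i \<in> ?Q" if "1 \<le> i" "i \<le> q" for i using bij_betwE[OF g] that by auto
  have ginj: "g i = g j \<longleftrightarrow> i = j" if "1 \<le> i" "i \<le> q" "1 \<le> j" "j \<le> q" for i j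
    using inj_on_eq_iff[OF bij_betw_imp_inj_on[OF g]] that by auto
  define h where "h i = (if i = 0 then z else if i \<le> q then g i else leaf (g (i - q)))" for i
  have img: "h ` {0..<2 * q + 1} = {0..<n}"
  proof
    show "h ` {0..<2 * q + 1} \<subseteq> {0..<n}"
    proof
      fix v assume "v \<in> h ` {0..<2 * q + 1}"
      then obtain i where i: "i < 2 * q + 1" "v = h i" by auto
      then have "v \<in> insert z (?Q \<union> leaf ` ?Q)"
        using gQ[of i] gQ[of "i - q"] by (auto simp: h_def)
      then show "v \<in> {0..<n}" unfolding V by simp
    qed
    show "{0..<n} \<subseteq> h ` {0..<2 * q + 1}"
    proof
      fix v assume "v \<in> {0..<n}"
      then have "v \<in> insert z (?Q \<union> leaf ` ?Q)" unfolding V by simp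
      then consider "v = z" | "v \<in> ?Q" | w where "w \<in> ?Q" "v = leaf w" by blast
      then show "v \<in> h ` {0..<2 * q + 1}"
      proof cases
        case 1
        then show ?thesis by (intro image_eqI[of _ _ 0]) (auto simp: h_def)
      next
        case 2
        then have "v \<in> g ` {1..q}" using g by (simp add: bij_betw_def)
        then obtain i where "i \<in> {1..q}" "v = g i" by blast
        then show ?thesis by (intro image_eqI[of _ _ i]) (auto simp: h_def)
      next
        case (3 w)
        then have "w \<in> g ` {1..q}" using g by (simp add: bij_betw_def)
        then obtain i where "i \<in> {1..q}" "w = g i" by blast
        then show ?thesis using 3 by (intro image_eqI[of _ _ "i + q"]) (auto simp: h_def)
      qed
    qed
  qed
  \<comment> \<open>A surjection between finite sets of equal size is injective, which saves
    comparing the branches of \<open>h\<close> with each other.\<close>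
  then have "card (h ` {0..<2 * q + 1}) = card {0..<2 * q + 1}" using n_eq by (simp add: q_def)
  then have "inj_on h {0..<2 * q + 1}" by (rule eq_card_imp_inj_on[OF finite_atLeastLessThan])
  then have bij: "bij_betw h {0..<2 * q + 1} {0..<n}" using img by (simp add: bij_betw_def)
  have "spider_edge q q u v \<longleftrightarrow> E (h u) (h v)" if uv: "u < 2 * q + 1" "v < 2 * q + 1" for u v
  proof -
    have cases: "w = 0 \<or> (1 \<le> w \<and> w \<le> q) \<or> (\<exists>i. w = q + i \<and> 1 \<le> i \<and> i \<le> q)"
      if "w < 2 * q + 1" for w
      using that by presburger
    have h0: "h 0 = z" by (simp add: h_def)
    have h1: "h i = g i" if "1 \<le> i" "i \<le> q" for i using that by (simp add: h_def)
    have h2: "h (q + i) = leaf (g i)" if "1 \<le> i" "i \<le> q" for i using that by (simp add: h_def)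
    have zQ: "E z w" "E w z" if "w \<in> ?Q" for w using near[OF that] sym by auto
    have zl: "\<not> E z (leaf w)" "\<not> E (leaf w) z" if "w \<in> ?Q" for w
      using edge_leaf[OF that] leaf_edge[OF that] z(2) that by auto
    have zg: "z \<noteq> g i" if "1 \<le> i" "i \<le> q" for i using gQ[OF that] z(2) by blast
    have lg: "leaf (g j) \<noteq> g i" if "1 \<le> i" "i \<le> q" "1 \<le> j" "j \<le> q" for i j
    proof
      assume "leaf (g j) = g i"
      then have "g i \<in> leaf ` ?Q" using imageI[OF gQ[OF that(3,4)], of leaf] by simp
      then show False using gQ[OF that(1,2)] disj by auto
    qed
    consider (a) "u = 0" | (b) "1 \<le> u" "u \<le> q" | (c) i where "u = q + i" "1 \<le> i" "i \<le> q"
      using cases[OF uv(1)] by blast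
    then show ?thesis
    proof cases
      case a
      consider "v = 0" | "1 \<le> v" "v \<le> q" | i where "v = q + i" "1 \<le> i" "i \<le> q"
        using cases[OF uv(2)] by blast
      then show ?thesis
        by cases (use a irr in \<open>auto simp: spider_edge_def h0 h1 h2 zQ zl gQ\<close>)
    next
      case b
      consider "v = 0" | "1 \<le> v" "v \<le> q" | i where "v = q + i" "1 \<le> i" "i \<le> q"
        using cases[OF uv(2)] by blast
      then show ?thesis
        by cases (use b in \<open>auto simp: spider_edge_def h0 h1 h2 zQ QQ gQ edge_leaf ginj\<close>)
    next
      case c
      consider "v = 0" | "1 \<le> v" "v \<le> q" | j where "v = q + j" "1 \<le> j" "j \<le> q"
        using cases[OF uv(2)] by blast
      then show ?thesis
        by cases (use c in \<open>auto simp: spider_edge_def h0 h1 h2 zg lg gQ leaf_edge ginj\<close>)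
    qed
  qed
  then have "graph_iso (2 * q + 1) (spider_edge q q) n E"
    using bij by (auto simp: graph_iso_def)
  then show ?thesis using graph_iso_sym by (simp add: spider_order_def q_def mult_2)
qed

text \<open>The permutation matrix \<open>P\<close> of \<open>f\<close> conjugates one Laplacian
  into the other. This carries the multiplicities of the spider over to the tree.\<close>

lemma char_poly_laplacian_iso:
  assumes "graph_iso n E m F" and G: "simple_graph m F"
  shows "char_poly (laplacian n E :: real mat) = char_poly (laplacian m F)"
proof -
  obtain f where f: "bij_betw f {0..<n} {0..<m}"
    and edge: "\<And>u v. u < n \<Longrightarrow> v < n \<Longrightarrow> E u v \<longleftrightarrow> F (f u) (f v)"
    using assms by (auto simp: graph_iso_def)
  have "card {0..<n} = card {0..<m}" using f by (rule bij_betw_same_card)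
  then have mn: "m = n" by simp
  have fl: "f u < n" if "u < n" for u using bij_betwE[OF f] that mn by auto
  have finj: "f u = f v \<longleftrightarrow> u = v" if "u < n" "v < n" for u v
    using inj_on_eq_iff[OF bij_betw_imp_inj_on[OF f]] that by auto
  have deg: "degree n E u = degree m F (f u)" if u: "u < n" for u
  proof -
    have "bij_betw f {w. w < n \<and> E u w} {w. w < m \<and> F (f u) w}"
      unfolding bij_betw_def
    proof
      show "inj_on f {w. w < n \<and> E u w}" using finj by (auto intro!: inj_onI)
      show "f ` {w. w < n \<and> E u w} = {w. w < m \<and> F (f u) w}"
      proof (intro equalityI subsetI)
        fix w assume "w \<in> f ` {w. w < n \<and> E u w}"
        then show "w \<in> {w. w < m \<and> F (f u) w}" using fl edge u mn by auto
      next
        fix w assume w: "w \<in> {w. w < m \<and> F (f u) w}"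
        then have "w \<in> f ` {0..<n}" using f by (simp add: bij_betw_def)
        then obtain v where "v < n" "w = f v" by auto
        then show "w \<in> f ` {w. w < n \<and> E u w}" using w edge u by auto
      qed
    qed
    then show ?thesis unfolding degree_def by (rule bij_betw_same_card)
  qed
  let ?L = "laplacian n E :: real mat" and ?M = "laplacian m F :: real mat"
  define P :: "real mat" where "P = mat n n (\<lambda>(i,j). if j = f i then 1 else 0)"
  have P: "P \<in> carrier_mat n n" "transpose_mat P \<in> carrier_mat n n" by (auto simp: P_def)
  have L: "?L \<in> carrier_mat n n" and M: "?M \<in> carrier_mat n n"
    using laplacian_carrier mn by auto
  have PPt: "P * transpose_mat P = 1\<^sub>m n"
  proof (rule eq_matI)
    fix i j assume "i < dim_row (1\<^sub>m n :: real mat)" "j < dim_col (1\<^sub>m n :: real mat)"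
    then have ij: "i < n" "j < n" by auto
    have "(P * transpose_mat P) $$ (i,j) = (\<Sum>k\<in>{0..<n}. P $$ (i,k) * P $$ (j,k))"
      using ij P(1) by (simp add: scalar_prod_def)
    also have "\<dots> = (\<Sum>k\<in>{0..<n}. if k = f i then (if f i = f j then 1 else 0) else 0)"
      using ij by (intro sum.cong) (auto simp: P_def)
    finally show "(P * transpose_mat P) $$ (i,j) = 1\<^sub>m n $$ (i,j)"
      using ij fl finj by simp
  qed (auto simp: P_def)
  have PtP: "transpose_mat P * P = 1\<^sub>m n"
    using mat_mult_left_right_inverse[OF P PPt] .
  have PM: "P * ?M = ?L * P"
  proof (rule eq_matI)
    fix i j assume "i < dim_row (?L * P)" "j < dim_col (?L * P)"
    then have ij: "i < n" "j < n" using L by (auto simp: P_def)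
    have "j \<in> f ` {0..<n}" using f ij(2) mn by (simp add: bij_betw_def)
    then obtain k where k: "k < n" "j = f k" by auto
    have "(P * ?M) $$ (i,j) = (\<Sum>l\<in>{0..<n}. P $$ (i,l) * ?M $$ (l,j))"
      using ij P(1) M by (simp add: scalar_prod_def)
    also have "\<dots> = (\<Sum>l\<in>{0..<n}. if l = f i then ?M $$ (l,j) else 0)"
      using ij by (intro sum.cong) (auto simp: P_def)
    also have "\<dots> = ?M $$ (f i, j)" using fl[OF ij(1)] by simp
    also have "\<dots> = ?L $$ (i,k)"
      using k ij fl[OF ij(1)] fl[OF k(1)] mn deg[OF ij(1)] edge[OF ij(1) k(1)] finj[OF ij(1) k(1)]
      by (cases "i = k") (simp_all add: laplacian_def)
    also have "\<dots> = (\<Sum>l\<in>{0..<n}. if l = k then ?L $$ (i,l) else 0)" using k by simp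
    also have "\<dots> = (\<Sum>l\<in>{0..<n}. ?L $$ (i,l) * P $$ (l,j))"
      using ij k finj by (intro sum.cong) (auto simp: P_def)
    also have "\<dots> = (?L * P) $$ (i,j)"
      using ij L P(1) by (simp add: scalar_prod_def)
    finally show "(P * ?M) $$ (i,j) = (?L * P) $$ (i,j)" .
  qed (use L M P in auto)
  have "P * ?M * transpose_mat P = ?L * (P * transpose_mat P)"
    unfolding PM using assoc_mult_mat[OF L P] .
  then have "?L = P * ?M * transpose_mat P" unfolding PPt using L by simp
  then have "similar_mat ?L ?M"
    by (intro similar_matI[of _ _ P "transpose_mat P" n]) (use L M P PPt PtP in auto)
  then show ?thesis by (rule char_poly_similar)
qed

text \<open>Justifies the definite description: diagonalization supplies a list of roots, the orders
  of the roots determine its multiset, and a multiset has only one sorted arrangement.\<close>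

lemma lap_spectrum_spec:
  assumes G: "simple_graph n E"
  shows "sorted (lap_spectrum n E)"
    and "char_poly (laplacian n E :: real mat) = (\<Prod>x\<leftarrow>lap_spectrum n E. [:- x, 1:])"
proof -
  let ?p = "char_poly (laplacian n E :: real mat)"
  obtain d P Q where p: "?p = (\<Prod>x\<leftarrow>map d [0..<n]. [:- x, 1:])"
    "\<forall>k<n. matrix_eigenfun n (laplacian n E) (d k) (\<lambda>i. P i k)"
    "\<forall>\<mu> x. matrix_eigenfun n (laplacian n E) \<mu> x \<longrightarrow>
       (\<forall>k<n. d k * (\<Sum>i<n. Q k i * x i) = \<mu> * (\<Sum>i<n. Q k i * x i))"
    "\<forall>x. \<forall>i<n. (\<Sum>k<n. P i k * (\<Sum>j<n. Q k j * x j)) = x i"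
    "\<forall>y. \<forall>k<n. (\<Sum>i<n. Q k i * (\<Sum>l<n. P i l * y l)) = y k"
    by (rule symmetric_eigenbasis[OF laplacian_carrier laplacian_symmetric[OF G]])
  let ?xs = "sort (map d [0..<n])"
  have "mset (map (\<lambda>x. [:- x, 1:]) ?xs) = mset (map (\<lambda>x. [:- x, 1:]) (map d [0..<n]))"
    by (simp only: mset_map mset_sort)
  then have "(\<Prod>x\<leftarrow>?xs. [:- x, 1:]) = (\<Prod>x\<leftarrow>map d [0..<n]. [:- x, 1:])"
    by (simp only: prod_mset_prod_list[symmetric])
  then have ex: "sorted ?xs \<and> ?p = (\<Prod>x\<leftarrow>?xs. [:- x, 1:])" using p(1) by simp
  have uniq: "ys = ?xs" if "sorted ys \<and> ?p = (\<Prod>x\<leftarrow>ys. [:- x, 1:])" for ys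
  proof -
    have "count_list ys a = count_list ?xs a" for a
      using that ex order_prod_linear_factors[of a ys] order_prod_linear_factors[of a ?xs] by simp
    then have "mset ys = mset ?xs" by (intro multiset_eqI) (simp only: count_mset)
    then show ?thesis using that properties_for_sort[of ys "map d [0..<n]"] by simp
  qed
  have "sorted (lap_spectrum n E) \<and> ?p = (\<Prod>x\<leftarrow>lap_spectrum n E. [:- x, 1:])"
    unfolding lap_spectrum_def by (rule theI[where a = ?xs], rule ex, rule uniq)
  then show "sorted (lap_spectrum n E)" "?p = (\<Prod>x\<leftarrow>lap_spectrum n E. [:- x, 1:])" by auto
qed

lemma count_lap_spectrum:
  assumes "simple_graph n E"
  shows "count_list (lap_spectrum n E) a = lap_mult n E a"
  using lap_spectrum_spec(2)[OF assms] order_prod_linear_factors[of a "lap_spectrum n E"]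
  by (simp add: lap_mult_def)

text \<open>\<open>gap\<close> also excludes negative eigenvalues, so the sorted spectrum starts
  with \<open>0\<close>. As \<open>0\<close> is simple, index \<open>1\<close> holds the least of
  the remaining eigenvalues.\<close>

lemma alg_conn_eq:
  assumes G: "simple_graph n E" and zero: "lap_mult n E 0 = 1" and \<theta>: "lap_mult n E \<theta> > 0" "\<theta> > 0"
    and gap: "\<And>a. a < \<theta> \<Longrightarrow> a \<noteq> 0 \<Longrightarrow> lap_mult n E a = 0"
  shows "alg_conn n E = \<theta>"
proof -
  let ?s = "lap_spectrum n E"
  have mem: "a \<in> set ?s \<longleftrightarrow> lap_mult n E a > 0" for a
    using count_lap_spectrum[OF G, of a] by (metis count_list_0_iff not_gr_zero)
  have ge: "a = 0 \<or> a \<ge> \<theta>" if "a \<in> set ?s" for a using that gap[of a] mem[of a] by force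
  obtain x ys where s: "?s = x # ys" using mem[of \<theta>] \<theta> by (cases ?s) auto
  have srt: "sorted (x # ys)" using lap_spectrum_spec(1)[OF G] s by simp
  have "0 \<in> set (x # ys)" using mem[of 0] zero s by simp
  then have "x \<le> 0" using srt by auto
  then have x: "x = 0" using ge[of x] s \<theta>(2) by auto
  have "count_list ys 0 = 0" using count_lap_spectrum[OF G, of 0] zero s x by simp
  then have "0 \<notin> set ys" by (simp add: count_list_0_iff)
  then have ge': "\<theta> \<le> a" if "a \<in> set ys" for a using ge[of a] s that by auto
  have \<theta>ys: "\<theta> \<in> set ys" using mem[of \<theta>] \<theta> s x by auto
  then obtain y zs where ys: "ys = y # zs" by (cases ys) auto
  have "y \<le> \<theta>" using srt \<theta>ys ys by auto
  then have "y = \<theta>" using ge'[of y] ys by simp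
  then show ?thesis by (simp add: alg_conn_def s ys)
qed

section \<open>The spider\<close>

lemma simple_graph_spider: "simple_graph (spider_order q q) (spider_edge q q)"
  by (auto simp: simple_graph_def spider_edge_def spider_order_def)

lemma spider_vertex_cases:
  assumes "v < spider_order q q"
  shows "v = 0 \<or> v \<in> {1..q} \<or> (\<exists>i\<in>{1..q}. v = q + i)"
proof (cases "v \<le> q")
  case False
  then have "v = q + (v - q)" "v - q \<in> {1..q}" using assms by (auto simp: spider_order_def)
  then show ?thesis by blast
qed auto

lemma lap_eigenfun_spider:
  "lap_eigenfun (spider_order q q) (spider_edge q q) \<mu> x \<longleftrightarrow>
     (\<Sum>i=1..q. x i) = (real q - \<mu>) * x 0 \<and>
     (\<forall>i\<in>{1..q}. x 0 + x (q + i) = (2 - \<mu>) * x i \<and> x i = (1 - \<mu>) * x (q + i))"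
proof -
  let ?n = "spider_order q q" and ?E = "spider_edge q q"
  have N0: "{u. u < ?n \<and> ?E 0 u} = {1..q}"
    by (auto simp: spider_edge_def spider_order_def)
  have Ni: "{u. u < ?n \<and> ?E i u} = {0, q + i}" if "i \<in> {1..q}" for i
    using that by (auto simp: spider_edge_def spider_order_def)
  have Nl: "{u. u < ?n \<and> ?E (q + i) u} = {i}" if "i \<in> {1..q}" for i
    using that by (auto simp: spider_edge_def spider_order_def)
  have all: "(\<forall>v<?n. R v) \<longleftrightarrow> R 0 \<and> (\<forall>i\<in>{1..q}. R i \<and> R (q + i))" for R
  proof
    assume R: "R 0 \<and> (\<forall>i\<in>{1..q}. R i \<and> R (q + i))"
    show "\<forall>v<?n. R v"
    proof (intro allI impI)
      fix v assume "v < ?n"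
      then show "R v" using R spider_vertex_cases[of v q] by auto
    qed
  qed (auto simp: spider_order_def)
  have "(\<Sum>u | u < ?n \<and> ?E i u. x u) = x 0 + x (q + i) \<and> degree ?n ?E i = 2" if "i \<in> {1..q}" for i
    unfolding degree_def Ni[OF that] using that by simp
  moreover have "(\<Sum>u | u < ?n \<and> ?E (q + i) u. x u) = x i \<and> degree ?n ?E (q + i) = 1" if "i \<in> {1..q}" for i
    unfolding degree_def Nl[OF that] by simp
  moreover have "degree ?n ?E 0 = q" unfolding degree_def N0 by simp
  ultimately show ?thesis unfolding lap_eigenfun_def all N0 by simp
qed

text \<open>The pair \<open>(1 - \<theta>, 1)\<close> on the two vertices of a leg solves the
  equations of that leg with zero at the centre. Placed on leg \<open>1\<close> and with opposite
  sign on leg \<open>j\<close>, it also satisfies the equation of the centre.\<close>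

lemma lap_mult_spider_ge:
  assumes \<theta>: "\<theta>\<^sup>2 - 3 * \<theta> + 1 = 0"
  shows "q - 1 \<le> lap_mult (spider_order q q) (spider_edge q q) \<theta>"
proof -
  define f where "f j v = (if v = 1 then 1 - \<theta> else if v = q + 1 then 1
    else if v = j then \<theta> - 1 else if v = q + j then - 1 else 0)" for j v :: nat
  have "card {2..q} \<le> lap_mult (spider_order q q) (spider_edge q q) \<theta>"
  proof (rule card_le_lap_mult[OF simple_graph_spider, where f = f])
    fix j assume j: "j \<in> {2..q}"
    have "(\<Sum>i=1..q. f j i) = (\<Sum>i\<in>{1, j}. f j i)"
      using j by (intro sum.mono_neutral_right) (auto simp: f_def)
    also have "\<dots> = 0" using j by (auto simp: f_def)
    finally have "(\<Sum>i=1..q. f j i) = (real q - \<theta>) * f j 0" using j by (simp add: f_def)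
    moreover have "f j 0 + f j (q + i) = (2 - \<theta>) * f j i \<and> f j i = (1 - \<theta>) * f j (q + i)" if "i \<in> {1..q}" for i
      using j that \<theta> by (auto simp: f_def algebra_simps power2_eq_square)
    ultimately show "lap_eigenfun (spider_order q q) (spider_edge q q) \<theta> (f j)"
      unfolding lap_eigenfun_spider by blast
  next
    fix c assume c: "\<forall>v<spider_order q q. (\<Sum>j\<in>{2..q}. c j * f j v) = 0"
    show "\<forall>j\<in>{2..q}. c j = 0"
    proof
      fix j assume j: "j \<in> {2..q}"
      \<comment> \<open>At the leaf \<open>q + j\<close> only \<open>f j\<close> is nonzero, since
        leg \<open>1\<close> is excluded from the index set.\<close>
      have "(\<Sum>k\<in>{2..q}. c k * f k (q + j)) = (\<Sum>k\<in>{j}. c k * f k (q + j))"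
        using j by (intro sum.mono_neutral_right) (auto simp: f_def)
      also have "\<dots> = - c j" using j by (simp add: f_def)
      finally have "(\<Sum>k\<in>{2..q}. c k * f k (q + j)) = - c j" .
      moreover have "q + j < spider_order q q" using j by (simp add: spider_order_def)
      ultimately have "- c j = 0" using c[rule_format, of "q + j"] by (simp only:)
      then show "c j = 0" by simp
    qed
  qed simp
  then show ?thesis by simp
qed

text \<open>A zero at the centre leaves on each leg a homogeneous system with determinant
  \<open>(2 - \<mu>) * (1 - \<mu>) - 1\<close>, which is the given quadratic.\<close>

lemma lap_eigenfun_spider_zero:
  assumes x: "lap_eigenfun (spider_order q q) (spider_edge q q) \<mu> x" and "x 0 = 0"
    and \<mu>: "\<mu>\<^sup>2 - 3 * \<mu> + 1 \<noteq> 0"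
  shows "\<forall>v<spider_order q q. x v = 0"
proof -
  have leg: "x i = 0 \<and> x (q + i) = 0" if "i \<in> {1..q}" for i
  proof -
    have "x 0 + x (q + i) = (2 - \<mu>) * x i \<and> x i = (1 - \<mu>) * x (q + i)"
      using x that unfolding lap_eigenfun_spider by blast
    then have *: "x (q + i) = (2 - \<mu>) * x i" "x i = (1 - \<mu>) * x (q + i)"
      unfolding assms(2) add_0 by blast+
    have "(\<mu>\<^sup>2 - 3 * \<mu> + 1) * x (q + i) = (2 - \<mu>) * ((1 - \<mu>) * x (q + i)) - x (q + i)"
      by (simp add: power2_eq_square algebra_simps)
    also have "\<dots> = 0" by (simp only: *[symmetric] diff_self)
    finally have "x (q + i) = 0" using \<mu> by simp
    then show ?thesis using *(2) by simp
  qed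
  show ?thesis
  proof (intro allI impI)
    fix v assume "v < spider_order q q"
    then show "x v = 0" using leg assms(2) spider_vertex_cases[of v q] by auto
  qed
qed

lemma lap_mult_spider_le_1:
  assumes \<mu>: "\<mu>\<^sup>2 - 3 * \<mu> + 1 \<noteq> 0"
  shows "lap_mult (spider_order q q) (spider_edge q q) \<mu> \<le> 1"
proof -
  have "lap_mult (spider_order q q) (spider_edge q q) \<mu> \<le> card {0 :: nat}"
  proof (rule lap_mult_le_card[OF simple_graph_spider])
    fix x assume x: "lap_eigenfun (spider_order q q) (spider_edge q q) \<mu> x" and "\<forall>v\<in>{0}. x v = 0"
    then have "x 0 = 0" by simp
    then show "\<forall>v<spider_order q q. x v = 0" by (rule lap_eigenfun_spider_zero[OF x _ \<mu>])
  qed simp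
  then show ?thesis by simp
qed

text \<open>The eigenvalues outside the roots of \<open>\<lambda>\<^sup>2 - 3 \<lambda> + 1\<close> are \<open>0\<close> and the two roots of
  \<open>\<lambda>\<^sup>2 - (q + 3) \<lambda> + 2 q + 1 = (\<lambda>\<^sup>2 - 3 \<lambda> + 1) + q (2 - \<lambda>)\<close>, which is positive below
  \<open>(3 - \<surd>5) / 2\<close>.\<close>

lemma lap_mult_spider_gap:
  assumes \<mu>: "\<mu> < (3 - sqrt 5) / 2" "\<mu> \<noteq> 0"
  shows "lap_mult (spider_order q q) (spider_edge q q) \<mu> = 0"
proof -
  define f where "f = \<mu>\<^sup>2 - 3 * \<mu> + 1"
  obtain s :: real where s: "s = sqrt 5" "s > 0" "s\<^sup>2 = 5" by simp
  have \<mu>s: "0 < 3 - s - 2 * \<mu>" using \<mu>(1) s(1) by (simp add: field_simps)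
  \<comment> \<open>The two factors are twice the differences between the smaller and the larger
    root and \<open>\<mu>\<close>.\<close>
  have f_eq: "f = (3 - s - 2 * \<mu>) * (3 - s - 2 * \<mu> + 2 * s) / 4"
    using s(3) by (simp add: f_def power2_eq_square algebra_simps)
  have "0 < 3 - s - 2 * \<mu> + 2 * s" using \<mu>s s(2) by (intro add_pos_pos) simp_all
  then have f: "f > 0"
    unfolding f_eq using \<mu>s by (intro divide_pos_pos mult_pos_pos) simp_all
  have "\<mu> < 2" using \<mu>s s(2) by linarith
  then have g: "f + real q * (2 - \<mu>) > 0" using f by (intro add_pos_nonneg) auto
  \<comment> \<open>With the empty set as \<open>S\<close> the bound says that \<open>\<mu>\<close>
    is not an eigenvalue.\<close>
  have "lap_mult (spider_order q q) (spider_edge q q) \<mu> \<le> card ({} :: nat set)"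
  proof (rule lap_mult_le_card[OF simple_graph_spider])
    fix x assume x: "lap_eigenfun (spider_order q q) (spider_edge q q) \<mu> x"
    have leg: "f * x i = (1 - \<mu>) * x 0" if "i \<in> {1..q}" for i
    proof -
      have *: "x 0 + x (q + i) = (2 - \<mu>) * x i" "x i = (1 - \<mu>) * x (q + i)"
        using x that unfolding lap_eigenfun_spider by blast+
      have "x 0 = (2 - \<mu>) * x i - x (q + i)" using *(1) by linarith
      then have "(1 - \<mu>) * x 0 = (1 - \<mu>) * ((2 - \<mu>) * x i - x (q + i))" by (simp only:)
      also have "\<dots> = (1 - \<mu>) * (2 - \<mu>) * x i - (1 - \<mu>) * x (q + i)"
        by (simp add: algebra_simps)
      also have "\<dots> = (1 - \<mu>) * (2 - \<mu>) * x i - x i" by (simp only: *(2)[symmetric])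
      also have "\<dots> = f * x i" by (simp add: f_def power2_eq_square algebra_simps)
      finally show ?thesis by simp
    qed
    have "(\<Sum>i=1..q. x i) = (real q - \<mu>) * x 0"
      using x unfolding lap_eigenfun_spider by blast
    then have "f * ((real q - \<mu>) * x 0) = (\<Sum>i=1..q. f * x i)"
      by (simp only: sum_distrib_left[symmetric])
    also have "\<dots> = (\<Sum>i=1..q. (1 - \<mu>) * x 0)" using leg by (intro sum.cong) auto
    also have "\<dots> = real q * ((1 - \<mu>) * x 0)" by simp
    finally have A: "f * ((real q - \<mu>) * x 0) = real q * ((1 - \<mu>) * x 0)" .
    \<comment> \<open>The legs have been eliminated from the equation of the centre. The factor
      \<open>\<mu>\<close> accounts for the eigenvalue \<open>0\<close>, the other factor is
      positive by \<open>g\<close>.\<close>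
    have "\<mu> * ((f + real q * (2 - \<mu>)) * x 0)
        = real q * ((1 - \<mu>) * x 0) - f * ((real q - \<mu>) * x 0)"
      by (simp add: f_def power2_eq_square algebra_simps)
    also have "\<dots> = 0" by (simp only: A diff_self)
    finally have "\<mu> * ((f + real q * (2 - \<mu>)) * x 0) = 0" .
    then have "x 0 = 0" using g \<mu>(2) by simp
    then show "\<forall>v<spider_order q q. x v = 0"
      using lap_eigenfun_spider_zero[OF x] f by (simp add: f_def)
  qed simp
  then show ?thesis by simp
qed

lemma lap_mult_spider_0: "lap_mult (spider_order q q) (spider_edge q q) 0 = 1"
proof -
  have "card {0 :: nat} \<le> lap_mult (spider_order q q) (spider_edge q q) 0"
  proof (rule card_le_lap_mult[OF simple_graph_spider, where f = "\<lambda>_ _. 1"])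
    show "lap_eigenfun (spider_order q q) (spider_edge q q) 0 (\<lambda>_. 1)"
      unfolding lap_eigenfun_spider by simp
    fix c :: "nat \<Rightarrow> real" assume "\<forall>v<spider_order q q. (\<Sum>j\<in>{0}. c j * 1) = 0"
    then have "(\<Sum>j\<in>{0}. c j * 1) = 0" by (elim allE[of _ 0]) (simp add: spider_order_def)
    then show "\<forall>j\<in>{0}. c j = 0" by simp
  qed simp
  moreover have "lap_mult (spider_order q q) (spider_edge q q) 0 \<le> 1"
    by (rule lap_mult_spider_le_1) simp
  ultimately show ?thesis by simp
qed

section \<open>The bound and its equality case\<close>

lemma golden_quadratic_iff:
  fixes \<mu> :: real
  shows "\<mu>\<^sup>2 - 3 * \<mu> + 1 = 0 \<longleftrightarrow> \<mu> = (3 + sqrt 5) / 2 \<or> \<mu> = (3 - sqrt 5) / 2"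
proof -
  have "\<mu>\<^sup>2 - 3 * \<mu> + 1 = (\<mu> - (3 + sqrt 5) / 2) * (\<mu> - (3 - sqrt 5) / 2)"
    by (simp add: power2_eq_square field_simps)
  then show ?thesis by simp
qed

text \<open>Completing the square, a rational root would make \<open>5\<close> a rational
  square.\<close>

lemma golden_quadratic_no_rat_root: "(x :: rat)\<^sup>2 - 3 * x + 1 \<noteq> 0"
proof
  assume "x\<^sup>2 - 3 * x + 1 = 0"
  then have y5: "(2 * x - 3)\<^sup>2 = 5" by (simp add: power2_eq_square algebra_simps)
  obtain a b where ab: "quotient_of (2 * x - 3) = (a, b)" by force
  have b: "b > 0" and cop: "coprime a b" and y: "2 * x - 3 = of_int a / of_int b"
    using quotient_of_denom_pos[OF ab] quotient_of_coprime[OF ab] quotient_of_div[OF ab] by auto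
  have "of_int (a\<^sup>2) = (of_int (5 * b\<^sup>2) :: rat)"
    using y5 b unfolding y by (simp add: power_divide field_simps)
  then have eq: "a\<^sup>2 = 5 * b\<^sup>2" by (simp only: of_int_eq_iff)
  have p5: "prime (5 :: int)" by simp
  have "5 dvd a\<^sup>2" using eq by simp
  then have "5 dvd a" by (rule prime_dvd_power[OF p5])
  then obtain k where k: "a = 5 * k" ..
  have "b\<^sup>2 = 5 * k\<^sup>2" using eq by (simp add: k power_mult_distrib)
  then have "5 dvd b\<^sup>2" by simp
  then have "5 dvd b" by (rule prime_dvd_power[OF p5])
  then have "is_unit (5 :: int)" by (rule coprime_common_divisor[OF cop \<open>5 dvd a\<close>])
  then show False by simp
qed

lemma irreducible_golden_quadratic: "irreducible [:1, -3, 1 :: rat:]"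
proof (rule irreducibleI)
  fix a b assume ab: "[:1, -3, 1 :: rat:] = a * b"
  then have nz: "a \<noteq> 0" "b \<noteq> 0" by auto
  have deg2: "Polynomial.degree a + Polynomial.degree b = 2"
    using degree_mult_eq[OF nz] ab[symmetric] by simp
  have deg1: "Polynomial.degree c \<noteq> 1" if dvd: "c dvd [:1, -3, 1 :: rat:]" for c
  proof
    assume "Polynomial.degree c = 1"
    then obtain u v where c: "c = [:u, v:]" "v \<noteq> 0" by (rule degree1_coeffs)
    then have 0: "poly c (- u / v) = 0" by simp
    obtain k where k: "[:1, -3, 1 :: rat:] = c * k" using dvd by (rule dvdE)
    have "poly [:1, -3, 1:] (- u / v) = 0" unfolding k poly_mult 0 by (rule mult_zero_left)
    moreover have "poly [:1, -3, 1:] x = x\<^sup>2 - 3 * x + 1" for x :: rat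
      by (simp add: power2_eq_square algebra_simps)
    ultimately show False using golden_quadratic_no_rat_root by metis
  qed
  have "Polynomial.degree a \<noteq> 1" "Polynomial.degree b \<noteq> 1" 
    by (rule deg1, unfold ab, rule dvd_triv_left) (rule deg1, unfold ab, rule dvd_triv_right)
  then have "Polynomial.degree a = 0 \<or> Polynomial.degree b = 0" using deg2 by arith
  then show "a dvd 1 \<or> b dvd 1" using nz by (auto simp: is_unit_iff_degree)
qed (auto simp: is_unit_iff_degree)

text \<open>The remainder of \<open>\<chi>\<close> modulo \<open>p\<close> has degree at most one,
  rational coefficients and the irrational zero \<open>\<theta>\<close>, so it is zero and
  \<open>p\<close> divides \<open>\<chi>\<close>. Being an eigenvalue is assumed of
  \<open>\<theta>\<close> only; \<open>\<theta>'\<close> enters as a root of the same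
  factor.\<close>

lemma lap_conjugates_golden:
  assumes m: "lap_mult n E \<theta> > 0"
    and \<theta>: "\<theta>\<^sup>2 - 3 * \<theta> + 1 = 0" and \<theta>': "\<theta>'\<^sup>2 - 3 * \<theta>' + 1 = 0"
  shows "lap_conjugates n E \<theta> \<theta>'"
proof -
  define p where "p = [:1, -3, 1 :: rat:]"
  define \<chi> where "\<chi> = char_poly (laplacian n E :: rat mat)"
  interpret h: map_poly_comm_ring_hom "of_rat :: rat \<Rightarrow> real" ..
  have hom: "map_mat of_rat (laplacian n E :: rat mat) = (laplacian n E :: real mat)"
    by (rule eq_matI) (auto simp: laplacian_def)
  have "map_poly of_rat \<chi> = char_poly (laplacian n E :: real mat)"
    unfolding hom[symmetric] \<chi>_def by (rule of_rat_hom.char_poly_hom[OF laplacian_carrier, symmetric])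
  moreover have "poly (char_poly (laplacian n E :: real mat)) \<theta> = 0"
  proof (rule ccontr)
    assume "poly (char_poly (laplacian n E :: real mat)) \<theta> \<noteq> 0"
    then have "lap_mult n E \<theta> = 0" unfolding lap_mult_def by (rule order_0I)
    then show False using m by simp
  qed
  ultimately have \<chi>0: "poly (map_poly of_rat \<chi>) \<theta> = 0" by simp
  have p_eval: "poly (map_poly of_rat p) x = x\<^sup>2 - 3 * x + 1" for x :: real
    by (simp add: p_def power2_eq_square algebra_simps)
  define r where "r = \<chi> mod p"
  have "Polynomial.degree r < 2"
    using degree_mod_less[of p \<chi>] by (auto simp: r_def p_def)
  then have "r = [:coeff r 0, coeff r 1:]"
    by (intro poly_eqI) (auto simp: coeff_pCons coeff_eq_0 split: nat.splits)
  then obtain a b where r: "r = [:a, b:]" by (rule that)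
  have "map_poly of_rat \<chi> = map_poly of_rat (\<chi> div p) * map_poly of_rat p + (map_poly of_rat r :: real poly)"
    unfolding r_def h.hom_mult[symmetric] h.hom_add[symmetric] div_mult_mod_eq ..
  then have "poly (map_poly of_rat r) \<theta> = 0"
    using \<chi>0 p_eval[of \<theta>] unfolding \<theta> by simp
  then have ab: "of_rat a + \<theta> * of_rat b = 0"
    by (cases "a = 0"; cases "b = 0") (simp_all add: r)
  have "b = 0"
  proof (rule ccontr)
    assume b: "b \<noteq> 0"
    then have "\<theta> = of_rat (- a / b)"
      using ab by (simp add: of_rat_divide of_rat_minus field_simps)
    then obtain x where "\<theta> = of_rat x" by blast
    then have "of_rat (x\<^sup>2 - 3 * x + 1) = (0 :: real)"
      using \<theta> by (simp add: of_rat_add of_rat_diff of_rat_mult of_rat_power)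
    then show False using golden_quadratic_no_rat_root[of x] by (simp only: of_rat_eq_0_iff)
  qed
  moreover from this have "a = 0" using ab by simp
  ultimately have "p dvd \<chi>" using r by (simp add: r_def dvd_eq_mod_eq_0)
  moreover have "poly (map_poly of_rat p) \<theta> = 0" "poly (map_poly of_rat p) \<theta>' = 0"
    unfolding p_eval by (fact \<theta> \<theta>')+
  moreover have "irreducible p" unfolding p_def by (rule irreducible_golden_quadratic)
  ultimately show ?thesis unfolding lap_conjugates_def \<chi>_def by blast
qed

text \<open>Over the natural numbers \<open>2 m + 4 \<le> n\<close> expresses strict inequality in
  the bound. The alternative contains the only candidates for equality and fixes the tree, but not
  yet \<open>\<mu>\<close>.\<close>

lemma tree_lap_mult_cases:
  assumes T: "is_tree n E" and n: "n \<ge> 6" and \<mu>: "\<mu> \<noteq> 1"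
  shows "2 * lap_mult n E \<mu> + 4 \<le> n \<or>
    (\<exists>q. n = 2 * q + 1 \<and> lap_mult n E \<mu> = q - 1 \<and> graph_iso n E (spider_order q q) (spider_edge q q))"
proof -
  let ?Q = "quasi_pendants E" and ?m = "lap_mult n E \<mu>"
  define q where "q = card ?Q"
  have n3: "n \<ge> 3" using n by simp
  note G = is_tree_simple[OF T]
  note fin = finite_quasi_pendants[OF G]
  obtain leaf where leaf: "\<And>w. w \<in> ?Q \<Longrightarrow> pendant E (leaf w) w"
    and "inj_on leaf ?Q" and "leaf ` ?Q \<inter> ?Q = {}"
    and sub: "?Q \<union> leaf ` ?Q \<subseteq> {..<n}" and card: "card (?Q \<union> leaf ` ?Q) = 2 * card ?Q"
    using quasi_pendant_leaves[OF T n3] by blast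
  note card = card[folded q_def]
  have "2 * q \<le> n" using card_mono[OF finite_lessThan sub] unfolding card card_lessThan .
  \<comment> \<open>The last case has \<open>q \<ge> 3\<close> because
    \<open>6 \<le> n \<le> 2 q + 1\<close>. In the case \<open>q \<le> 1\<close> the bound
    \<open>m \<le> 1\<close> suffices, again because \<open>6 \<le> n\<close>.\<close>
  consider "q \<le> 1" | "q \<ge> 2" "2 * q + 2 \<le> n" | "q \<ge> 3" "n \<le> 2 * q + 1"
    using n by linarith
  then show ?thesis
  proof cases
    case 1
    then have "?m \<le> 1" using lap_mult_le_1_of_quasi_pendants[OF T \<mu>] by (simp add: q_def)
    then have "2 * ?m + 4 \<le> n" using n by simp
    then show ?thesis by blast
  next
    case 2
    then have "?m \<le> q - 1" using lap_mult_le_quasi_pendants[OF T n3 \<mu>] by (simp add: q_def)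
    then have "2 * ?m + 4 \<le> n" using 2 by arith
    then show ?thesis by blast
  next
    case 3
    have m: "?m \<le> q - 1" using 3 lap_mult_le_quasi_pendants[OF T n3 \<mu>] by (simp add: q_def)
    show ?thesis
    proof (cases "\<forall>v<n. v \<in> ?Q \<or> (\<exists>w. pendant E v w)")
      case True
      then have "?m + 2 \<le> q"
        unfolding q_def using 3(1) by (intro lap_mult_le_of_corona[OF T \<mu>]) (simp_all add: q_def)
      then have "2 * ?m + 4 \<le> n" using \<open>2 * q \<le> n\<close> by simp
      then show ?thesis by blast
    next
      case False
      then obtain z where z: "z < n" "z \<notin> ?Q" "\<And>w. \<not> pendant E z w" by blast
      have "z \<noteq> leaf w" if "w \<in> ?Q" for w using leaf[OF that] z(3)[of w] by metis
      then have "z \<notin> ?Q \<union> leaf ` ?Q" using z(2) by blast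
      then have c: "card (insert z (?Q \<union> leaf ` ?Q)) = 2 * q + 1" using card fin by simp
      have sub': "insert z (?Q \<union> leaf ` ?Q) \<subseteq> {..<n}" using sub z(1) by simp
      have "2 * q + 1 \<le> card {..<n}" unfolding c[symmetric] by (rule card_mono[OF finite_lessThan sub'])
      then have n_eq: "n = 2 * q + 1" using 3(2) by simp
      then have "card (insert z (?Q \<union> leaf ` ?Q)) = card {..<n}" unfolding c by simp
      then have V: "insert z (?Q \<union> leaf ` ?Q) = {..<n}"
        by (rule card_subset_eq[OF finite_lessThan sub'])
      have cover: "v \<in> ?Q \<or> (\<exists>w. pendant E v w)" if v: "v < n" "v \<noteq> z" for v
      proof -
        have "v \<in> insert z (?Q \<union> leaf ` ?Q)" unfolding V using v(1) by simp
        then consider "v \<in> ?Q" | w where "w \<in> ?Q" "v = leaf w" using v(2) by blast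
        then show ?thesis
        proof cases
          case (2 w)
          then have "pendant E v w" using leaf by simp
          then show ?thesis by blast
        qed blast
      qed
      show ?thesis
      proof (cases "\<forall>u\<in>?Q. E u z")
        case True
        have iso: "graph_iso n E (spider_order q q) (spider_edge q q)"
          unfolding q_def
        proof (rule graph_iso_spider[OF T n3 z])
          show "n = 2 * card ?Q + 1" using n_eq unfolding q_def .
        qed (use True in blast)
        show ?thesis
        proof (cases "?m = q - 1")
          case True
          then show ?thesis using n_eq iso by blast
        next
          case False
          then have "2 * ?m + 4 \<le> n" using m n_eq 3 by arith
          then show ?thesis by blast
        qed
      next
        case False
        then obtain u where u: "u \<in> ?Q" "\<not> E u z" by blast
        have "?m + 2 \<le> q"
          unfolding q_def by (rule lap_mult_le_of_extra_vertex[OF T \<mu> z _ u]) (rule cover)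
        then have "2 * ?m + 4 \<le> n" using n_eq by simp
        then show ?thesis by blast
      qed
    qed
  qed
qed

theorem theorem4p1:
  fixes n :: nat and E :: "nat \<Rightarrow> nat \<Rightarrow> bool" and \<mu> :: real
  assumes "is_tree n E" and "n \<ge> 6"
    and "eigenvalue (laplacian n E :: real mat) \<mu>" and "\<mu> \<noteq> 1"
  shows "real (lap_mult n E \<mu>) \<le> (real n - 3) / 2 \<and>
         (real (lap_mult n E \<mu>) = (real n - 3) / 2 \<longleftrightarrow>
           (graph_iso n E (spider_order ((n - 1) div 2) ((n - 1) div 2))
                          (spider_edge ((n - 1) div 2) ((n - 1) div 2)) \<and>
            (\<mu> = (3 + sqrt 5) / 2 \<or> \<mu> = (3 - sqrt 5) / 2))) \<and>
         (real (lap_mult n E \<mu>) = (real n - 3) / 2 \<longrightarrow>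
           (\<mu> = alg_conn n E \<or> lap_conjugates n E \<mu> (alg_conn n E)))"
proof -
  note G = is_tree_simple[OF assms(1)]
  let ?m = "lap_mult n E" and ?s = "(n - 1) div 2"
  let ?iso = "graph_iso n E (spider_order ?s ?s) (spider_edge ?s ?s)"
  let ?golden = "\<mu> = (3 + sqrt 5) / 2 \<or> \<mu> = (3 - sqrt 5) / 2"
  have spider: "?m x = lap_mult (spider_order ?s ?s) (spider_edge ?s ?s) x" if ?iso for x
    unfolding lap_mult_def using char_poly_laplacian_iso[OF that simple_graph_spider] by simp
  have eq_iff: "real (?m \<mu>) = (real n - 3) / 2 \<longleftrightarrow> 2 * ?m \<mu> + 3 = n"
  proof -
    have "real (?m \<mu>) = (real n - 3) / 2 \<longleftrightarrow> real (2 * ?m \<mu> + 3) = real n"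
      by (auto simp: field_simps)
    then show ?thesis by (simp only: of_nat_eq_iff)
  qed
  have le: "2 * ?m \<mu> + 3 \<le> n"
    using tree_lap_mult_cases[OF assms(1,2,4)]
  proof (elim disjE exE conjE)
    fix q assume "n = 2 * q + 1" "?m \<mu> = q - 1"
    then show ?thesis using assms(2) by arith
  qed simp
  have forward: "?iso \<and> ?golden" if eq: "2 * ?m \<mu> + 3 = n"
  proof -
    obtain q where q: "n = 2 * q + 1" "?m \<mu> = q - 1"
      and iso_q: "graph_iso n E (spider_order q q) (spider_edge q q)"
      using tree_lap_mult_cases[OF assms(1,2,4)] eq by auto
    have "?s = q" using q(1) by simp
    then have iso: ?iso using iso_q by simp
    \<comment> \<open>Equality and \<open>n \<ge> 6\<close> give multiplicity at least two, while
      off the roots of the quadratic the spider has multiplicity at most one.\<close>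
    have "?m \<mu> > 1" using eq assms(2) by simp
    moreover have "?m \<mu> \<le> 1" if "\<mu>\<^sup>2 - 3 * \<mu> + 1 \<noteq> 0"
      unfolding spider[OF iso] by (rule lap_mult_spider_le_1[OF that])
    ultimately have "\<mu>\<^sup>2 - 3 * \<mu> + 1 = 0" by linarith
    then show ?thesis using iso golden_quadratic_iff by blast
  qed
  \<comment> \<open>Comparing the numbers of vertices shows that \<open>n\<close> is odd, so
    \<open>?s\<close> involves no rounding. The root \<open>x\<close> is arbitrary because the claim
    is applied to \<open>\<mu>\<close> and to the smaller root.\<close>
  have backward: "?m x \<ge> ?s - 1 \<and> 2 * ?s + 1 = n" if iso: ?iso and x: "x\<^sup>2 - 3 * x + 1 = 0" for x
  proof -
    obtain f where "bij_betw f {0..<n} {0..<spider_order ?s ?s}"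
      using iso unfolding graph_iso_def by blast
    then have "card {0..<n} = card {0..<spider_order ?s ?s}" by (rule bij_betw_same_card)
    then have "2 * ?s + 1 = n" by (simp add: spider_order_def)
    then show ?thesis using lap_mult_spider_ge[OF x, of ?s] unfolding spider[OF iso] by blast
  qed
  have conj: "\<mu> = alg_conn n E \<or> lap_conjugates n E \<mu> (alg_conn n E)" if eq: "2 * ?m \<mu> + 3 = n"
  proof -
    have iso: ?iso and golden: ?golden using forward[OF eq] by auto
    have "sqrt 5 < 3" by (rule real_less_lsqrt) auto
    then have pos: "(3 - sqrt 5) / 2 > (0 :: real)" by simp
    have low: "((3 - sqrt 5) / 2)\<^sup>2 - 3 * ((3 - sqrt 5) / 2) + 1 = (0 :: real)"
      unfolding golden_quadratic_iff by blast
    have mlow: "?m ((3 - sqrt 5) / 2) > 0"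
      using backward[OF iso low] assms(2) by linarith
    have ac: "alg_conn n E = (3 - sqrt 5) / 2"
    proof (rule alg_conn_eq[OF G _ mlow pos])
      show "?m 0 = 1" unfolding spider[OF iso] by (rule lap_mult_spider_0)
      show "?m a = 0" if "a < (3 - sqrt 5) / 2" "a \<noteq> 0" for a
        unfolding spider[OF iso] using that by (rule lap_mult_spider_gap)
    qed
    have "?m \<mu> > 0" using eq assms(2) by simp
    then show ?thesis unfolding ac
      using golden lap_conjugates_golden[OF _ _ low, of n E \<mu>] golden_quadratic_iff[of \<mu>] by blast
  qed
  have "2 * ?m \<mu> + 3 = n \<longleftrightarrow> ?iso \<and> ?golden"
  proof
    assume h: "?iso \<and> ?golden"
    then have "\<mu>\<^sup>2 - 3 * \<mu> + 1 = 0" using golden_quadratic_iff by blast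
    then have "?m \<mu> \<ge> ?s - 1 \<and> 2 * ?s + 1 = n" using backward h by blast
    then show "2 * ?m \<mu> + 3 = n" using le assms(2) by linarith
  qed (rule forward)
  moreover have "real (?m \<mu>) \<le> (real n - 3) / 2"
  proof -
    have "real (2 * ?m \<mu> + 3) \<le> real n" using le by (simp only: of_nat_le_iff)
    then show ?thesis by (simp add: field_simps)
  qed
  ultimately show ?thesis unfolding eq_iff using conj by blast
qed

end
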